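(* Let $\alpha\in(0,1)$ be irrational with continued fraction convergents $p_n/q_n$, let $J_n$ be as in the context, fix $\tau\in(0,\tfrac13)$, and let $$I_n=\bigcup_{k\in J_n}\Big(\{k\alpha\}-\frac{\tau}{q_{n+1}},\ \{k\alpha\}+\frac{\tau}{q_{n+1}}\Big).$$ Let $(n_k)$ be a strictly increasing sequence of positive integers such that for every interval $I\subset[0,1)$ one has $\#\{m\in J_{n_k}:\{m\alpha\}\in I\}=(\kappa|I|+o(1))q_{n_k+1}$ as $k\to\infty$. Then for each fixed index $l_1$, $$|I_{n_{l_1}}\cap I_{n_{l_2}}|=|I_{n_{l_1}}|\,|I_{n_{l_2}}|+o(1)\qquad\text{as } l_2\to\infty.$$
   Context: The continued fraction expansion of $\alpha$ is $\alpha=[a_1,a_2,\dots]=1/(a_1+1/(a_2+\cdots))$ and $p_n/q_n=[a_1,\dots,a_n]$ in lowest terms. $J_n=\{k\in[1,q_{n+1}-1]\cap\mathbb{Z}:\gcd(\lfloor k\alpha\rfloor,k)=1\}$. $\{x\}$ is the fractional part of $x$, $|\cdot|$ is Lebesgue measure, and $\kappa=\prod_{p\text{ prime}}(1-p^{-2})=6/\pi^2$. *)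

theory Defs
  imports "HOL-Analysis.Analysis" "HOL-Library.Landau_Symbols"
    "HOL-Computational_Algebra.Primes"
begin

text \<open>Iterates of the Gauss map $x \mapsto \{1/x\}$ starting at $\alpha$.\<close>

primrec cf_remainder :: "real \<Rightarrow> nat \<Rightarrow> real" where
  "cf_remainder \<alpha> 0 = \<alpha>"
| "cf_remainder \<alpha> (Suc n) = frac (1 / cf_remainder \<alpha> n)"

text \<open>Indexing starts at 1: for irrational $\alpha \in (0,1)$ the expansion is
  $[a_1, a_2, \dots]$ with $a_n$ given by \<open>cf_digit \<alpha> n\<close> (the value at 0 is meaningless).\<close>

definition cf_digit :: "real \<Rightarrow> nat \<Rightarrow> int" where
  "cf_digit \<alpha> n = \<lfloor>1 / cf_remainder \<alpha> (n - 1)\<rfloor>"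

primrec cf_value :: "int list \<Rightarrow> rat" where
  "cf_value [] = 0"
| "cf_value (a # as) = 1 / (of_int a + cf_value as)"

definition cf_convergent :: "real \<Rightarrow> nat \<Rightarrow> rat" where
  "cf_convergent \<alpha> n = cf_value (map (cf_digit \<alpha>) [1..<Suc n])"

text \<open>The function \<^const>\<open>quotient_of\<close> returns numerator and denominator in lowest terms,
  with positive denominator.\<close>

definition cf_denom :: "real \<Rightarrow> nat \<Rightarrow> nat" where
  "cf_denom \<alpha> n = nat (snd (quotient_of (cf_convergent \<alpha> n)))"

definition J_set :: "real \<Rightarrow> nat \<Rightarrow> nat set" where
  "J_set \<alpha> n = {k \<in> {1..cf_denom \<alpha> (n + 1) - 1}. gcd \<lfloor>real k * \<alpha>\<rfloor> (int k) = 1}"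

definition I_set :: "real \<Rightarrow> real \<Rightarrow> nat \<Rightarrow> real set" where
  "I_set \<alpha> \<tau> n = (\<Union>k\<in>J_set \<alpha> n.
     {frac (real k * \<alpha>) - \<tau> / real (cf_denom \<alpha> (n + 1)) <..<
      frac (real k * \<alpha>) + \<tau> / real (cf_denom \<alpha> (n + 1))})"

definition \<kappa> :: real where
  "\<kappa> = (\<Prod>p. if prime p then 1 - 1 / real p ^ 2 else 1)"

end

theory Submission
  imports Defs
begin

text \<open>Write \<open>Q = q\<^bsub>n+1\<^esub>\<close> and \<open>x\<^sub>m = {m \<alpha>}\<close>. For \<open>0 < j < Q\<close> the distance from \<open>j \<alpha>\<close> to the nearest
  integer exceeds \<open>1 / (2 Q)\<close>, so that for \<open>\<tau> < 1 / 3\<close> no point lies in three of the intervals forming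
  \<open>I\<^sub>n\<close>. Two of them do overlap for suitable \<open>\<alpha>\<close> once \<open>\<tau> > 1 / 4\<close>, so equidistribution of \<open>J\<^sub>n\<close>
  alone is not enough: one also needs the distribution of the pairs \<open>m\<close>, \<open>m + j\<close> in \<open>J\<^sub>n\<close>, for
  the at most three differences \<open>j\<close> that give rise to overlaps.

  Replace \<open>J\<^sub>n\<close> by the larger set of those \<open>m\<close> for which no prime \<open>p \<le> P\<close> divides both \<open>m\<close> and
  \<open>\<lfloor>m \<alpha>\<rfloor>\<close>. Membership depends only on residues modulo a fixed number, and since \<open>\<alpha>\<close> is
  fixed, equidistribution of the multiples of \<open>\<alpha>\<close> shows that singles and pairs of this set are
  equidistributed in every interval. The set has density \<open>\<Prod>p\<le>P. 1 - 1 / p\<^sup>2\<close>, which tends to \<open>\<kappa>\<close>; by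
  hypothesis, applied to \<open>[0,1)\<close>, \<open>J\<^sub>n\<close> has density \<open>\<kappa>\<close>, so the replacement changes the measures
  by an amount that tends to \<open>0\<close> as \<open>P\<close> grows.\<close>

section \<open>Separation of the multiples of \<open>\<alpha>\<close>\<close>

fun cf_numer_rec :: "(nat \<Rightarrow> int) \<Rightarrow> nat \<Rightarrow> int" where
  "cf_numer_rec d 0 = 0"
| "cf_numer_rec d (Suc 0) = 1"
| "cf_numer_rec d (Suc (Suc n)) = d (Suc (Suc n)) * cf_numer_rec d (Suc n) + cf_numer_rec d n"

fun cf_denom_rec :: "(nat \<Rightarrow> int) \<Rightarrow> nat \<Rightarrow> int" where
  "cf_denom_rec d 0 = 1"
| "cf_denom_rec d (Suc 0) = d 1"
| "cf_denom_rec d (Suc (Suc n)) = d (Suc (Suc n)) * cf_denom_rec d (Suc n) + cf_denom_rec d n"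

text \<open>A continued fraction whose last digit is followed by a tail \<open>x\<close>. It is
  polymorphic because it serves both the rational convergents, with tail \<open>0\<close>, and the
  real number \<alpha>, whose tail is an iterate of the Gauss map.\<close>

primrec cf_tail_value :: "int list \<Rightarrow> 'a::linordered_field \<Rightarrow> 'a" where
  "cf_tail_value [] x = x"
| "cf_tail_value (a # as) x = 1 / (of_int a + cf_tail_value as x)"

lemma cf_tail_value_snoc:
  "cf_tail_value (as @ [a]) x = cf_tail_value as (1 / (of_int a + x))"
  by (induction as) auto

lemma cf_value_eq_tail_value: "cf_value as = cf_tail_value as 0"
  by (induction as) auto

text \<open>One step of the recurrences is multiplication by an integer matrix of determinant -1.
  This gives lowest terms, and makes two consecutive convergent vectors a basis of the integer
  lattice.\<close>

lemma cf_rec_det: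
  "cf_numer_rec d (Suc n) * cf_denom_rec d n - cf_numer_rec d n * cf_denom_rec d (Suc n) = (-1) ^ n"
  by (induction n) (auto simp: algebra_simps)

lemma cf_rec_coprime: "coprime (cf_numer_rec d (Suc n)) (cf_denom_rec d (Suc n))"
proof (rule coprimeI)
  fix c assume "c dvd cf_numer_rec d (Suc n)" "c dvd cf_denom_rec d (Suc n)"
  then have "c dvd (-1) ^ n" unfolding cf_rec_det[symmetric, of n d] by simp
  then show "is_unit c" by (rule dvd_trans) simp
qed

context
  fixes d :: "nat \<Rightarrow> int"
  assumes digit_pos: "\<And>i. 1 \<le> d i"
begin

lemma cf_denom_rec_pos: "1 \<le> cf_denom_rec d n"
proof (induction n rule: induct_nat_012)
  case (ge2 n)
  then have "1 * 1 \<le> d (Suc (Suc n)) * cf_denom_rec d (Suc n)"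
    using digit_pos[of "Suc (Suc n)"] by (intro mult_mono) auto
  then show ?case using ge2 by force
qed (auto simp: digit_pos)

lemma cf_denom_rec_step:
  "cf_denom_rec d (Suc n) + cf_denom_rec d n \<le> cf_denom_rec d (Suc (Suc n))"
  using mult_right_mono[OF digit_pos[of "Suc (Suc n)"], of "cf_denom_rec d (Suc n)"]
    cf_denom_rec_pos[of "Suc n"] by simp

lemma cf_denom_rec_mono: "cf_denom_rec d n \<le> cf_denom_rec d (Suc n)"
proof (cases n)
  case 0
  then show ?thesis using digit_pos by simp
next
  case (Suc k)
  then show ?thesis using cf_denom_rec_step[of k] cf_denom_rec_pos[of k] unfolding Suc by linarith
qed

lemma cf_denom_rec_ge: "int n \<le> cf_denom_rec d n"
proof (induction n)
  case (Suc n)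
  show ?case
  proof (cases n)
    case 0
    then show ?thesis using digit_pos by simp
  next
    case (Suc k)
    then show ?thesis
      using cf_denom_rec_step[of k] cf_denom_rec_pos[of k] Suc.IH unfolding Suc by (simp del: cf_denom_rec.simps)
  qed
qed simp

text \<open>The tail enters through the Moebius transformation formed from the last two convergents.
  In the induction the last digit \<open>a\<close> is absorbed into the tail, which becomes
  \<open>1 / (a + x)\<close>; hence \<open>x\<close> is arbitrary.\<close>

lemma cf_tail_value_eq:
  fixes x :: "'a::linordered_field"
  assumes "0 \<le> x"
  shows "cf_tail_value (map d [1..<Suc (Suc n)]) x =
    (of_int (cf_numer_rec d (Suc n)) + of_int (cf_numer_rec d n) * x) /
    (of_int (cf_denom_rec d (Suc n)) + of_int (cf_denom_rec d n) * x)"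
  using assms
proof (induction n arbitrary: x)
  case (Suc n)
  let ?a = "d (Suc (Suc n))"
  have a: "of_int ?a + x > 0"
    using digit_pos[of "Suc (Suc n)"] Suc.prems by (simp add: add_pos_nonneg)
  have "cf_tail_value (map d [1..<Suc (Suc (Suc n))]) x
      = cf_tail_value (map d [1..<Suc (Suc n)] @ [?a]) x" by simp
  also have "\<dots> = cf_tail_value (map d [1..<Suc (Suc n)]) (1 / (of_int ?a + x))"
    by (rule cf_tail_value_snoc)
  also have "\<dots> = (of_int (cf_numer_rec d (Suc n)) + of_int (cf_numer_rec d n) * (1 / (of_int ?a + x))) /
    (of_int (cf_denom_rec d (Suc n)) + of_int (cf_denom_rec d n) * (1 / (of_int ?a + x)))"
    using a by (intro Suc.IH) auto
  also have "\<dots> = (of_int (cf_numer_rec d (Suc (Suc n))) + of_int (cf_numer_rec d (Suc n)) * x) /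
    (of_int (cf_denom_rec d (Suc (Suc n))) + of_int (cf_denom_rec d (Suc n)) * x)" (is "?l = ?r")
  proof -
    have "?l = ((of_int (cf_numer_rec d (Suc n)) + of_int (cf_numer_rec d n) * (1 / (of_int ?a + x))) * (of_int ?a + x)) /
    ((of_int (cf_denom_rec d (Suc n)) + of_int (cf_denom_rec d n) * (1 / (of_int ?a + x))) * (of_int ?a + x))"
      using a by simp
    also have "\<dots> = ?r"
      using a by (simp add: distrib_right) (simp add: algebra_simps)
    finally show ?thesis .
  qed
  finally show ?case .
qed simp

end

section \<open>Convergents of an irrational number\<close>

context
  fixes \<alpha> :: real
  assumes \<alpha>_pos: "0 < \<alpha>" and \<alpha>_less_1: "\<alpha> < 1" and irrational: "\<alpha> \<notin> \<rat>"
begin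

text \<open>Irrationality survives each step of the Gauss map, so no iterate is 0 and the expansion
  never stops.\<close>

lemma cf_remainder_props:
  "0 < cf_remainder \<alpha> n \<and> cf_remainder \<alpha> n < 1 \<and> cf_remainder \<alpha> n \<notin> \<rat>"
proof (induction n)
  case 0
  then show ?case using \<alpha>_pos \<alpha>_less_1 irrational by simp
next
  case (Suc n)
  have i: "1 / cf_remainder \<alpha> n \<notin> \<rat>"
    using Suc Rats_inverse[of "1 / cf_remainder \<alpha> n"] by (auto simp: divide_inverse)
  then have "frac (1 / cf_remainder \<alpha> n) \<notin> \<rat>"
    unfolding frac_def by (metis Rats_add Rats_of_int diff_add_cancel)
  moreover have "frac (1 / cf_remainder \<alpha> n) \<noteq> 0"
    using i Ints_subset_Rats by (auto simp: frac_eq_0_iff)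
  ultimately show ?case
    using frac_ge_0[of "1 / cf_remainder \<alpha> n"] frac_lt_1[of "1 / cf_remainder \<alpha> n"]
    by (simp add: order_less_le del: frac_eq_0_iff)
qed

text \<open>The bound includes index 0, where the truncated \<open>n - 1\<close> is again 0; the
  recurrence lemmas assume it at every index.\<close>

lemma cf_digit_ge_1: "1 \<le> cf_digit \<alpha> n"
  using cf_remainder_props[of "n - 1"] unfolding cf_digit_def by (simp add: le_floor_iff)

lemma cf_remainder_expand: "cf_tail_value (map (cf_digit \<alpha>) [1..<Suc n]) (cf_remainder \<alpha> n) = \<alpha>"
proof (induction n)
  case (Suc n)
  have "cf_remainder \<alpha> n = 1 / (of_int (cf_digit \<alpha> (Suc n)) + cf_remainder \<alpha> (Suc n))"
    by (simp add: cf_digit_def frac_def)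
  then show ?case using Suc by (simp add: cf_tail_value_snoc)
qed simp

lemma cf_denom_eq: "int (cf_denom \<alpha> (Suc n)) = cf_denom_rec (cf_digit \<alpha>) (Suc n)"
proof -
  let ?h = "cf_numer_rec (cf_digit \<alpha>) (Suc n)" and ?k = "cf_denom_rec (cf_digit \<alpha>) (Suc n)"
  have "cf_convergent \<alpha> (Suc n) = Fract ?h ?k"
    unfolding cf_convergent_def cf_value_eq_tail_value
    using cf_tail_value_eq[where d = "cf_digit \<alpha>", OF cf_digit_ge_1, where x = "0::rat" and n = n]
    by (simp add: Fract_of_int_quotient del: upt_Suc)
  moreover have "coprime ?h ?k" by (rule cf_rec_coprime)
  moreover have "?k > 0"
    using cf_denom_rec_pos[where d = "cf_digit \<alpha>", OF cf_digit_ge_1, of "Suc n"] by linarith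
  ultimately have "quotient_of (cf_convergent \<alpha> (Suc n)) = (?h, ?k)"
    by (simp add: quotient_of_Fract normalize_stable)
  then show ?thesis using \<open>?k > 0\<close> by (simp add: cf_denom_def)
qed

lemma cf_denom_ge: "Suc n \<le> cf_denom \<alpha> (Suc n)"
  using cf_denom_eq[of n] cf_denom_rec_ge[where d = "cf_digit \<alpha>", OF cf_digit_ge_1, of "Suc n"] by simp

text \<open>\<open>D\<close> is the denominator of \<alpha> in its Moebius form with tail
  \<open>r\<close>. Scaled by \<open>D\<close>, two consecutive approximation errors become 1 and
  \<open>r\<close> up to sign, and their signs are opposite.\<close>

lemma cf_linear_form:
  obtains D r :: real where "0 < r" "r < 1"
    "of_int (cf_denom_rec (cf_digit \<alpha>) (Suc n)) < D"
    "D < 2 * of_int (cf_denom_rec (cf_digit \<alpha>) (Suc n))"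
    "D * (of_int (cf_denom_rec (cf_digit \<alpha>) n) * \<alpha> - of_int (cf_numer_rec (cf_digit \<alpha>) n)) = (-1) ^ n"
    "D * (of_int (cf_denom_rec (cf_digit \<alpha>) (Suc n)) * \<alpha> - of_int (cf_numer_rec (cf_digit \<alpha>) (Suc n)))
      = - ((-1) ^ n * r)"
proof -
  define d and r :: real and h k h' k' where "d = cf_digit \<alpha>" and "r = cf_remainder \<alpha> (Suc n)"
    and "h = cf_numer_rec d n" and "k = cf_denom_rec d n"
    and "h' = cf_numer_rec d (Suc n)" and "k' = cf_denom_rec d (Suc n)"
  have d1: "\<And>i. 1 \<le> d i" unfolding d_def by (rule cf_digit_ge_1)
  have r: "0 < r" "r < 1" unfolding r_def using cf_remainder_props by blast+
  have k: "1 \<le> k" "k \<le> k'"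
    unfolding k_def k'_def using cf_denom_rec_pos[where d = d, OF d1] cf_denom_rec_mono[where d = d, OF d1] by auto
  have kr: "0 < of_int k * r" "of_int k * r < of_int k'"
    using k r by (auto intro: order_less_le_trans[of _ "of_int k :: real"])
  let ?D = "of_int k' + of_int k * r"
  have "\<alpha> = (of_int h' + of_int h * r) / ?D"
    using cf_tail_value_eq[where d = d, OF d1, where x = r and n = n] cf_remainder_expand[of "Suc n"] r
    unfolding d_def r_def h_def k_def h'_def k'_def by simp
  then have *: "?D * \<alpha> = of_int h' + of_int h * r"
    using kr k by (simp add: add_pos_pos)
  have det: "of_int h' * of_int k - of_int h * of_int k' = (-1 :: real) ^ n"
    using arg_cong[OF cf_rec_det[of d n], of "of_int :: int \<Rightarrow> real"]
    unfolding h_def k_def h'_def k'_def by simp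
  have "?D * (of_int k * \<alpha> - of_int h) = of_int k * (?D * \<alpha>) - ?D * of_int h"
    by (simp add: algebra_simps)
  also have "\<dots> = (-1) ^ n"
    unfolding * det[symmetric] by (simp add: algebra_simps)
  finally have 1: "?D * (of_int k * \<alpha> - of_int h) = (-1) ^ n" .
  have "?D * (of_int k' * \<alpha> - of_int h') = of_int k' * (?D * \<alpha>) - ?D * of_int h'"
    by (simp add: algebra_simps)
  also have "\<dots> = - ((-1) ^ n * r)"
    unfolding * det[symmetric] by (simp add: algebra_simps)
  finally have 2: "?D * (of_int k' * \<alpha> - of_int h') = - ((-1) ^ n * r)" .
  show ?thesis
    using that[of r ?D] r kr 1 2 unfolding d_def h_def k_def h'_def k'_def by simp
qed

text \<open>The vector \<open>(j, b)\<close> is an integer combination of two consecutive convergent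
  vectors. The range of \<open>j\<close> forbids coefficients of equal sign, so, the errors having
  opposite signs, nothing cancels: \<open>D\<close> times the distance is at least 1, and
  \<open>D\<close> is less than twice the denominator.\<close>

lemma cf_denom_separation:
  fixes b :: int
  assumes "0 < j" and "j < cf_denom \<alpha> (Suc n)"
  shows "1 / (2 * real (cf_denom \<alpha> (Suc n))) < \<bar>real j * \<alpha> - of_int b\<bar>"
proof -
  define h k h' k' where "h = cf_numer_rec (cf_digit \<alpha>) n" and "k = cf_denom_rec (cf_digit \<alpha>) n"
    and "h' = cf_numer_rec (cf_digit \<alpha>) (Suc n)" and "k' = cf_denom_rec (cf_digit \<alpha>) (Suc n)"
  obtain D r where r: "0 < r" "r < 1" and D: "of_int k' < D" "D < 2 * of_int k'"
    and 1: "D * (of_int k * \<alpha> - of_int h) = (-1) ^ n"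
    and 2: "D * (of_int k' * \<alpha> - of_int h') = - ((-1) ^ n * r)"
    using cf_linear_form[of n] unfolding h_def k_def h'_def k'_def by metis
  have k: "1 \<le> k" unfolding k_def using cf_denom_rec_pos cf_digit_ge_1 by blast
  have k': "int (cf_denom \<alpha> (Suc n)) = k'" unfolding k'_def by (rule cf_denom_eq)
  then have rk': "real (cf_denom \<alpha> (Suc n)) = of_int k'" by (metis of_int_of_nat_eq)
  define s :: int where "s = (-1) ^ n"
  have s: "h' * k - h * k' = s" "s * s = 1" "\<bar>s\<bar> = 1"
    unfolding s_def h_def k_def h'_def k'_def using cf_rec_det by (auto simp: power_mult_distrib[symmetric])
  \<comment> \<open>Cramer's rule; the determinant \<open>s\<close> is 1 or -1, so it is its own
    inverse.\<close>
  define x y where "x = s * (int j * h' - b * k')" and "y = s * (b * k - int j * h)"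
  have "x * k + y * k' = s * (h' * k - h * k') * int j"
    unfolding x_def y_def by (simp add: algebra_simps)
  then have j: "int j = x * k + y * k'" using s by simp
  have "x * h + y * h' = s * (h' * k - h * k') * b"
    unfolding x_def y_def by (simp add: algebra_simps)
  then have b: "b = x * h + y * h'" using s by simp
  have "D * (real j * \<alpha> - of_int b) = of_int x * (D * (of_int k * \<alpha> - of_int h))
      + of_int y * (D * (of_int k' * \<alpha> - of_int h'))"
  proof -
    have "real j = of_int x * of_int k + of_int y * of_int k'"
      using j by (metis of_int_add of_int_mult of_int_of_nat_eq)
    then show ?thesis unfolding b by (simp add: algebra_simps)
  qed
  also have "\<dots> = of_int s * (of_int x - of_int y * r)"
    unfolding 1 2 s_def by (simp add: algebra_simps)
  finally have "\<bar>D * (real j * \<alpha> - of_int b)\<bar> = \<bar>of_int x - of_int y * r\<bar>"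
    using s(3) by (simp add: abs_mult flip: of_int_abs)
  moreover have "1 \<le> \<bar>of_int x - of_int y * r\<bar>"
  proof -
    have jb: "0 < x * k + y * k'" "x * k + y * k' < k'" "0 < k'" using assms j k' by auto
    consider "1 \<le> y" | "y = 0" | "y \<le> -1" by linarith
    then show ?thesis
    proof cases
      case 1
      then have "k' \<le> y * k'" using jb(3) by simp
      then have "x * k < 0" using jb by linarith
      then have "x \<le> -1" using k by (simp add: mult_less_0_iff)
      then have "of_int x \<le> (-1::real)" by linarith
      moreover have "0 \<le> of_int y * r" using 1 r by simp
      ultimately show ?thesis by linarith
    next
      case 2
      then have "0 < x" using jb k by (simp add: zero_less_mult_iff)
      then show ?thesis using 2 by simp
    next
      case 3
      then have "y * k' < 0" using jb(3) by (simp add: mult_less_0_iff)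
      then have "0 < x * k" using jb by linarith
      then have "1 \<le> x" using k by (simp add: zero_less_mult_iff)
      then have "(1::real) \<le> of_int x" by simp
      moreover have "of_int y * r \<le> 0" using 3 r by (simp add: mult_nonpos_nonneg)
      ultimately show ?thesis by linarith
    qed
  qed
  moreover have Dpos: "0 < D" using D assms k' by linarith
  ultimately have "1 / D \<le> \<bar>real j * \<alpha> - of_int b\<bar>"
    unfolding abs_mult by (simp add: field_simps)
  moreover have "1 / (2 * real (cf_denom \<alpha> (Suc n))) < 1 / D"
    using D Dpos rk' by (intro divide_strict_left_mono) auto
  ultimately show ?thesis by linarith
qed

text \<open>The convergent of index \<open>N + 1\<close> works, because its denominator is at least
  its index.\<close>

lemma coprime_approximation:
  obtains p :: int and q :: nat where "N < q" "coprime p (int q)" "\<bar>real q * \<alpha> - of_int p\<bar> < 1 / real q"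
proof -
  define h k where "h = cf_numer_rec (cf_digit \<alpha>) (Suc N)" and "k = cf_denom_rec (cf_digit \<alpha>) (Suc N)"
  obtain D r where r: "0 < r" "r < 1" and D: "of_int k < D" "D < 2 * of_int k"
    and 2: "D * (of_int k * \<alpha> - of_int h) = - ((-1) ^ N * r)"
    using cf_linear_form[of N] unfolding h_def k_def by metis
  have k: "int (cf_denom \<alpha> (Suc N)) = k" unfolding k_def by (rule cf_denom_eq)
  have kN: "int N < k" using k cf_denom_ge[of N] by linarith
  have "\<bar>D * (of_int k * \<alpha> - of_int h)\<bar> = r" unfolding 2 using r by (simp add: abs_mult)
  then have "\<bar>of_int k * \<alpha> - of_int h\<bar> = r / D"
    using D kN unfolding abs_mult by (simp add: field_simps)
  also have "\<dots> < 1 / of_int k"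
    using r D kN by (intro frac_less) auto
  finally have "\<bar>real (nat k) * \<alpha> - of_int h\<bar> < 1 / real (nat k)" using kN by simp
  moreover have "coprime h (int (nat k))"
    using cf_rec_coprime[of "cf_digit \<alpha>" N] kN unfolding h_def k_def by simp
  ultimately show ?thesis using that[of "nat k" h] kN by simp
qed

end

section \<open>Joint equidistribution with residues\<close>

lemma card_ints_between:
  fixes a b :: real
  assumes "a \<le> b"
  shows "finite {w::int. a \<le> of_int w \<and> of_int w \<le> b}"
    and "real (card {w::int. a \<le> of_int w \<and> of_int w \<le> b}) \<le> b - a + 1"
proof -
  have *: "{w::int. a \<le> of_int w \<and> of_int w \<le> b} = {\<lceil>a\<rceil>..\<lfloor>b\<rfloor>}"
    by (auto simp: ceiling_le_iff le_floor_iff)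
  show "finite {w::int. a \<le> of_int w \<and> of_int w \<le> b}" unfolding * by simp
  show "real (card {w::int. a \<le> of_int w \<and> of_int w \<le> b}) \<le> b - a + 1"
    unfolding * using assms by simp linarith
qed

text \<open>Along one period of a rational approximation \<open>p / q\<close>, the rotation by \<open>\<alpha>\<close> moves each
  point by less than \<open>1 / q\<close> compared with the rotation by \<open>p / q\<close>, whose orbit is evenly spaced.\<close>

lemma card_rotation_period_le:
  fixes \<alpha> c u v :: real and p :: int and q :: nat
  assumes "0 < q" "coprime p (int q)" "\<bar>real q * \<alpha> - of_int p\<bar> < 1 / real q" "u \<le> v"
  shows "real (card {t \<in> {..<q}. frac (c + real t * \<alpha>) \<in> {u..v}}) \<le> real q * (v - u) + 3"
proof -
  let ?A = "{t \<in> {..<q}. frac (c + real t * \<alpha>) \<in> {u..v}}"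
  let ?W = "{w::int. real q * (u - c) - 1 \<le> of_int w \<and> of_int w \<le> real q * (v - c) + 1}"
  \<comment> \<open>Modulo \<open>q\<close> this is \<open>t * p\<close>, so it determines
    \<open>t\<close>. Up to an error of at most 1 it equals \<open>q\<close> times the fractional
    part minus \<open>c\<close>, which confines it to \<open>?W\<close>.\<close>
  define f where "f t = int t * p - \<lfloor>c + real t * \<alpha>\<rfloor> * int q" for t
  have le: "real q * (u - c) - 1 \<le> real q * (v - c) + 1"
    using mult_left_mono[OF \<open>u \<le> v\<close>, of "real q"] by (simp add: algebra_simps)
  have "inj_on f ?A"
  proof (rule inj_onI)
    fix t t' assume t: "t \<in> ?A" "t' \<in> ?A" and "f t = f t'"
    then have "(int t - int t') * p = (\<lfloor>c + real t * \<alpha>\<rfloor> - \<lfloor>c + real t' * \<alpha>\<rfloor>) * int q"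
      unfolding f_def by (simp add: algebra_simps)
    then have "int q dvd (int t - int t') * p" by simp
    then have "int q dvd int t - int t'"
      using assms(2) by (simp add: coprime_dvd_mult_left_iff coprime_commute)
    then have "int t mod int q = int t' mod int q" by (simp add: mod_eq_dvd_iff)
    then show "t = t'" using t by simp
  qed
  moreover have "f ` ?A \<subseteq> ?W"
  proof (rule image_subsetI)
    fix t assume t: "t \<in> ?A"
    define e where "e = real t * (real q * \<alpha> - of_int p)"
    have "\<bar>e\<bar> \<le> real q * \<bar>real q * \<alpha> - of_int p\<bar>"
      unfolding e_def abs_mult using t by (intro mult_right_mono) auto
    also have "\<dots> \<le> 1" using assms(1,3) by (simp add: field_simps)
    finally have e: "\<bar>e\<bar> \<le> 1" .
    have "real_of_int (f t) = real q * (frac (c + real t * \<alpha>) - c) - e"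
      unfolding f_def e_def frac_def by (simp add: algebra_simps)
    moreover have "real q * (u - c) \<le> real q * (frac (c + real t * \<alpha>) - c)"
      "real q * (frac (c + real t * \<alpha>) - c) \<le> real q * (v - c)"
      using t by (auto intro!: mult_left_mono)
    ultimately show "f t \<in> ?W" using e by simp linarith
  qed
  ultimately have "card ?A \<le> card ?W"
    using card_ints_between(1)[OF le] by (rule card_inj_on_le)
  then have "real (card ?A) \<le> real (card ?W)" by simp
  also have "\<dots> \<le> real q * (v - c) + 1 - (real q * (u - c) - 1) + 1"
    by (rule card_ints_between(2)[OF le])
  finally show ?thesis by (simp add: algebra_simps)
qed

text \<open>Removing a block of length \<open>q\<close> restarts the orbit at
  \<open>c + q * \<alpha>\<close>, hence the arbitrary \<open>c\<close>. Each full block costs an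
  error of 3; the incomplete last one is charged as a whole block.\<close>

lemma card_rotation_le:
  fixes \<alpha> c u v :: real and p :: int and q :: nat
  assumes "0 < q" "coprime p (int q)" "\<bar>real q * \<alpha> - of_int p\<bar> < 1 / real q" "u \<le> v"
  shows "real (card {t \<in> {..<T}. frac (c + real t * \<alpha>) \<in> {u..v}})
    \<le> real T * (v - u) + 3 * real T / real q + (real q * (v - u) + 3)"
proof (induction T arbitrary: c rule: less_induct)
  case (less T)
  let ?A = "\<lambda>c T. {t \<in> {..<T}. frac (c + real t * \<alpha>) \<in> {u..v}}"
  show ?case
  proof (cases "T < q")
    case True
    then have "card (?A c T) \<le> card (?A c q)" by (intro card_mono) auto
    then have "real (card (?A c T)) \<le> real q * (v - u) + 3"
      using card_rotation_period_le[OF assms, of c] by linarith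
    moreover have "0 \<le> real T * (v - u) + 3 * real T / real q" using assms by simp
    ultimately show ?thesis by linarith
  next
    case False
    let ?c = "c + real q * \<alpha>"
    have "?A c T \<subseteq> ?A c q \<union> (\<lambda>t. t + q) ` ?A ?c (T - q)"
    proof
      fix t assume t: "t \<in> ?A c T"
      show "t \<in> ?A c q \<union> (\<lambda>t. t + q) ` ?A ?c (T - q)"
      proof (cases "t < q")
        case False
        then have "t - q \<in> ?A ?c (T - q)" "t = (t - q) + q"
          using t by (auto simp: of_nat_diff algebra_simps)
        then show ?thesis by blast
      qed (use t in auto)
    qed
    then have "card (?A c T) \<le> card (?A c q \<union> (\<lambda>t. t + q) ` ?A ?c (T - q))"
      by (rule card_mono[rotated]) auto
    also have "\<dots> \<le> card (?A c q) + card ((\<lambda>t. t + q) ` ?A ?c (T - q))" by (rule card_Un_le)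
    also have "\<dots> \<le> card (?A c q) + card (?A ?c (T - q))" by (intro add_left_mono card_image_le) auto
    finally have "real (card (?A c T)) \<le> real (card (?A c q)) + real (card (?A ?c (T - q)))" by linarith
    also have "\<dots> \<le> (real q * (v - u) + 3) + (real (T - q) * (v - u) + 3 * real (T - q) / real q + (real q * (v - u) + 3))"
      using less.IH[of "T - q" ?c] False assms card_rotation_period_le[OF assms, of c] by (intro add_mono) auto
    also have "\<dots> = real T * (v - u) + 3 * real T / real q + (real q * (v - u) + 3)"
      using False assms by (simp add: of_nat_diff field_simps)
    finally show ?thesis .
  qed
qed

text \<open>Upper bounds suffice: applied to the two complementary intervals they give the lower
  bound. \<open>C\<close> comes from \<open>q\<close> alone, so the estimate is uniform in the
  starting point \<open>c\<close>.\<close>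

lemma rotation_equidistributed:
  fixes \<alpha> u v \<epsilon> :: real
  assumes "0 < \<alpha>" "\<alpha> < 1" "\<alpha> \<notin> \<rat>" and "0 \<le> u" "u \<le> v" "v \<le> 1" and "0 < \<epsilon>"
  obtains C where "0 \<le> C"
    "\<And>c T. \<bar>real (card {t \<in> {..<T}. frac (c + real t * \<alpha>) \<in> {u<..<v}}) - real T * (v - u)\<bar> \<le> \<epsilon> * real T + C"
proof -
  obtain N :: nat where N: "9 / \<epsilon> < real N" using reals_Archimedean2 by blast
  obtain p q where q: "N < q" "coprime p (int q)" "\<bar>real q * \<alpha> - of_int p\<bar> < 1 / real q"
    using coprime_approximation[OF assms(1-3)] by metis
  have qpos: "0 < q" using q by simp
  have "9 / \<epsilon> < real q" using N q by linarith
  then have eps: "9 / real q \<le> \<epsilon>" using qpos assms(7) by (simp add: field_simps)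
  let ?N = "\<lambda>c T S. real (card {t \<in> {..<T}. frac (c + real t * \<alpha>) \<in> S})"
  note ub = card_rotation_le[OF qpos q(2,3)]
  have "\<bar>?N c T {u<..<v} - real T * (v - u)\<bar> \<le> \<epsilon> * real T + (real q + 9)" for c T
  proof -
    have T: "3 * (3 * real T / real q) \<le> \<epsilon> * real T"
      using mult_right_mono[OF eps, of "real T"] by simp
    have le: "real q * u \<le> real q" "real q * (v - u) \<le> real q" "real q * (1 - v) \<le> real q"
      using assms by (auto intro!: mult_left_le)
    have nn: "0 \<le> real q * u" "0 \<le> real q * (v - u)" "0 \<le> real q * (1 - v)" "0 \<le> 3 * real T / real q"
      using assms by auto
    have "?N c T {u<..<v} \<le> ?N c T {u..v}"
      by (intro of_nat_mono card_mono) auto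
    also have "\<dots> \<le> real T * (v - u) + 3 * real T / real q + (real q * (v - u) + 3)"
      by (rule ub[OF assms(5)])
    finally have up: "?N c T {u<..<v} \<le> real T * (v - u) + (\<epsilon> * real T + (real q + 9))"
      using T le nn by linarith
    have "x \<in> {0..u} \<or> x \<in> {u<..<v} \<or> x \<in> {v..1}" if "x = frac y" for x y :: real
      using that frac_ge_0[of y] frac_lt_1[of y] by auto
    then have "card {..<T} \<le> card ({t \<in> {..<T}. frac (c + real t * \<alpha>) \<in> {0..u}} \<union>
        {t \<in> {..<T}. frac (c + real t * \<alpha>) \<in> {u<..<v}} \<union> {t \<in> {..<T}. frac (c + real t * \<alpha>) \<in> {v..1}})"
      by (intro card_mono) (simp, blast)
    also have "\<dots> \<le> card {t \<in> {..<T}. frac (c + real t * \<alpha>) \<in> {0..u}} +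
        card {t \<in> {..<T}. frac (c + real t * \<alpha>) \<in> {u<..<v}} + card {t \<in> {..<T}. frac (c + real t * \<alpha>) \<in> {v..1}}"
      by (intro order_trans[OF card_Un_le] add_mono card_Un_le order_refl)
    finally have "real T \<le> ?N c T {0..u} + ?N c T {u<..<v} + ?N c T {v..1}" by simp
    moreover have "?N c T {0..u} \<le> real T * (u - 0) + 3 * real T / real q + (real q * (u - 0) + 3)"
      "?N c T {v..1} \<le> real T * (1 - v) + 3 * real T / real q + (real q * (1 - v) + 3)"
      by (rule ub, use assms in simp)+
    moreover have "real q * u + real q * (1 - v) \<le> real q" "real T = real T * u + real T * (v - u) + real T * (1 - v)"
      using nn by (auto simp: algebra_simps)
    ultimately have "real T * (v - u) - (\<epsilon> * real T + (real q + 9)) \<le> ?N c T {u<..<v}"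
      using T nn unfolding diff_0_right by linarith
    with up show ?thesis by linarith
  qed
  moreover have "0 \<le> real q + 9" by simp
  ultimately show ?thesis using that by blast
qed

section \<open>Counts of multiples with prescribed residues\<close>

text \<open>The pair \<open>m mod L\<close>, \<open>\<lfloor>m \<alpha>\<rfloor> mod L\<close> together with the fractional part of \<open>m \<alpha>\<close> can be read off
  from \<open>m mod L\<close> and the fractional part of \<open>m \<alpha> / L\<close>; this reduces joint equidistribution to a rotation.\<close>

lemma frac_div_iff:
  fixes x u v :: real and s :: int and L :: nat
  assumes "0 \<le> u" "v \<le> 1" "0 \<le> s" "s < int L"
  shows "\<lfloor>x\<rfloor> mod int L = s \<and> frac x \<in> {u<..<v} \<longleftrightarrow>
    frac (x / real L) \<in> {(of_int s + u) / real L<..<(of_int s + v) / real L}"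
proof -
  have L: "0 < L" using assms by simp
  define z r where "z = \<lfloor>x\<rfloor> div int L" and "r = \<lfloor>x\<rfloor> mod int L"
  have r: "0 \<le> r" "r < int L" unfolding r_def using L by auto
  have fl: "\<lfloor>x\<rfloor> = int L * z + r" unfolding z_def r_def by simp
  have x: "x = real L * of_int z + of_int r + frac x"
    unfolding frac_def fl by simp
  have fr: "frac (x / real L) = (of_int r + frac x) / real L"
  proof -
    have "of_int r + frac x < real L" using r frac_lt_1[of x] by linarith
    then have "(of_int r + frac x) / real L < 1" using L by simp
    moreover have "0 \<le> (of_int r + frac x) / real L" using r by simp
    moreover have "x / real L - (of_int r + frac x) / real L = of_int z"
      using L by (subst (1) x) (simp add: field_simps)
    ultimately show ?thesis by (subst frac_unique_iff) auto
  qed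
  have "(of_int s + u) / real L < (of_int r + frac x) / real L \<and> (of_int r + frac x) / real L < (of_int s + v) / real L
    \<longleftrightarrow> of_int s + u < of_int r + frac x \<and> of_int r + frac x < of_int s + v"
    using L by (simp add: divide_less_cancel)
  also have "\<dots> \<longleftrightarrow> r = s \<and> u < frac x \<and> frac x < v"
  proof
    assume *: "of_int s + u < of_int r + frac x \<and> of_int r + frac x < of_int s + v"
    then have "real_of_int s < of_int (r + 1)" "real_of_int r < of_int (s + 1)"
      using assms frac_lt_1[of x] frac_ge_0[of x] unfolding of_int_add of_int_1 by linarith+
    then have "r = s" by linarith
    then show "r = s \<and> u < frac x \<and> frac x < v" using * by simp
  qed auto
  finally show ?thesis unfolding fr r_def by auto
qed

text \<open>Writing \<open>m = r + L * t\<close> leaves a rotation by \<alpha> in \<open>t\<close>,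
  with a target interval of length \<open>(v - u) / L\<close>. About \<open>N / L\<close> values of
  \<open>t\<close> occur, whence the square of \<open>L\<close>.\<close>

lemma card_residue_class:
  fixes \<alpha> u v \<epsilon> :: real
  assumes "0 < \<alpha>" "\<alpha> < 1" "\<alpha> \<notin> \<rat>" and uv: "0 \<le> u" "u \<le> v" "v \<le> 1" and "0 < \<epsilon>"
    and rs: "r < L" "0 \<le> s" "s < int L"
  obtains C where "0 \<le> C"
    "\<And>N. \<bar>real (card {m \<in> {1..<N}. m mod L = r \<and> \<lfloor>real m * \<alpha>\<rfloor> mod int L = s \<and> frac (real m * \<alpha>) \<in> {u<..<v}})
      - real N * (v - u) / (real L)\<^sup>2\<bar> \<le> \<epsilon> * real N + C"
proof -
  have L: "0 < L" using rs by simp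
  let ?u = "(of_int s + u) / real L" and ?v = "(of_int s + v) / real L"
  have "0 \<le> ?u" "?u \<le> ?v" using L rs uv by (auto intro!: divide_right_mono)
  moreover have "of_int s + v \<le> real L" using rs uv by linarith
  then have "?v \<le> 1" using L by simp
  ultimately have uv': "0 \<le> ?u" "?u \<le> ?v" "?v \<le> 1" by blast+
  obtain C where C: "0 \<le> C" and
    eq: "\<And>c T. \<bar>real (card {t \<in> {..<T}. frac (c + real t * \<alpha>) \<in> {?u<..<?v}}) - real T * (?v - ?u)\<bar> \<le> \<epsilon> * real T + C"
    using rotation_equidistributed[OF assms(1-3) uv' assms(7)] by blast
  show ?thesis
  proof (rule that[of "\<epsilon> + C + 2"])
    fix N
    \<comment> \<open>The number of \<open>t\<close> with \<open>r + L * t < N\<close>. Adding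
      \<open>L - 1\<close> before subtracting \<open>r\<close> rounds up and avoids truncation, as
      \<open>r < L\<close>.\<close>
    define T where "T = (N + L - 1 - r) div L"
    have T: "t < T \<longleftrightarrow> r + L * t < N" for t
    proof -
      have "t < T \<longleftrightarrow> t + 1 \<le> T" by auto
      also have "\<dots> \<longleftrightarrow> (t + 1) * L \<le> N + L - 1 - r"
        unfolding T_def using L by (simp add: less_eq_div_iff_mult_less_eq)
      also have "\<dots> \<longleftrightarrow> r + L * t < N" using rs by (auto simp: algebra_simps)
      finally show ?thesis .
    qed
    have TN: "\<bar>real T - real N / real L\<bar> \<le> 1"
    proof -
      have "N \<le> r + L * T" using T[of T] by simp
      then have "real N \<le> real r + real L * real T" by (metis of_nat_add of_nat_le_iff of_nat_mult)
      then have "real N \<le> real L * (real T + 1)" using rs by (simp add: algebra_simps)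
      moreover have "real L * (real T - 1) \<le> real N"
      proof (cases T)
        case (Suc t)
        then have "r + L * t \<le> N" using T[of t] by simp
        then have "L * t \<le> N" by simp
        then have "real L * real t \<le> real N" by (metis of_nat_le_iff of_nat_mult)
        then show ?thesis using Suc by simp
      qed (use L in simp)
      ultimately show ?thesis using L by (simp add: abs_le_iff field_simps)
    qed
    let ?M = "{m \<in> {..<N}. m mod L = r \<and> \<lfloor>real m * \<alpha>\<rfloor> mod int L = s \<and> frac (real m * \<alpha>) \<in> {u<..<v}}"
    let ?M1 = "{m \<in> {1..<N}. m mod L = r \<and> \<lfloor>real m * \<alpha>\<rfloor> mod int L = s \<and> frac (real m * \<alpha>) \<in> {u<..<v}}"
    \<comment> \<open>Index 0 drops out by itself: its fractional part 0 lies outside the open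
      interval, since \<open>u\<close> is nonnegative.\<close>
    have "?M1 = ?M" using uv by (auto simp: Suc_le_eq intro!: gr0I)
    also have "\<dots> = (\<lambda>t. r + L * t) ` {t \<in> {..<T}. frac (real r * \<alpha> / real L + real t * \<alpha>) \<in> {?u<..<?v}}"
    proof -
      have *: "real (r + L * t) * \<alpha> / real L = real r * \<alpha> / real L + real t * \<alpha>" for t
        using L by (simp add: field_simps)
      have "m \<in> (\<lambda>t. r + L * t) ` {t \<in> {..<T}. frac (real r * \<alpha> / real L + real t * \<alpha>) \<in> {?u<..<?v}}"
        if m: "m \<in> ?M" for m
      proof -
        have "m = r + L * (m div L)" using m mult_div_mod_eq[of L m] by simp
        then obtain t where t: "m = r + L * t" by blast
        have "frac (real m * \<alpha> / real L) \<in> {?u<..<?v}" using m frac_div_iff[OF uv(1,3) rs(2,3)] by blast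
        then show ?thesis using m T[of t] unfolding t * by auto
      qed
      moreover have "r + L * t \<in> ?M" if "t < T" "frac (real r * \<alpha> / real L + real t * \<alpha>) \<in> {?u<..<?v}" for t
        using frac_div_iff[OF uv(1,3) rs(2,3), of "real (r + L * t) * \<alpha>"] that rs(1) T[of t] unfolding * by auto
      ultimately show ?thesis by blast
    qed
    finally have "card ?M1 = card {t \<in> {..<T}. frac (real r * \<alpha> / real L + real t * \<alpha>) \<in> {?u<..<?v}}"
      using L by (simp add: card_image inj_on_def)
    then have 1: "\<bar>real (card ?M1) - real T * (?v - ?u)\<bar> \<le> \<epsilon> * real T + C"
      using eq by simp
    have vu: "?v - ?u = (v - u) / real L" using L by (simp add: field_simps)
    have "(v - u) / real L \<le> 1" using uv L by (simp add: divide_le_eq) 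
    then have "\<bar>(real T - real N / real L) * ((v - u) / real L)\<bar> \<le> 1 * 1"
      unfolding abs_mult using TN uv by (intro mult_mono) auto
    then have 2: "\<bar>real T * (?v - ?u) - real N * (v - u) / (real L)\<^sup>2\<bar> \<le> 1"
      unfolding vu by (simp add: algebra_simps power2_eq_square)
    have "real N / real L \<le> real N" using L by (simp add: divide_le_eq) (simp add: mult_le_cancel_left1)
    then have "real T \<le> real N + 1" using TN by linarith
    then have 3: "\<epsilon> * real T \<le> \<epsilon> * real N + \<epsilon>"
      using mult_left_mono[of "real T" "real N + 1" \<epsilon>] assms by (simp add: algebra_simps)
    have tri: "\<bar>a - b\<bar> \<le> e + C \<Longrightarrow> \<bar>b - c\<bar> \<le> 1 \<Longrightarrow> e \<le> f + \<epsilon> \<Longrightarrow> \<bar>a - c\<bar> \<le> f + (\<epsilon> + C + 2)"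
      for a b c e f :: real by linarith
    show "\<bar>real (card ?M1) - real N * (v - u) / (real L)\<^sup>2\<bar> \<le> \<epsilon> * real N + (\<epsilon> + C + 2)"
      by (rule tri[OF 1 2 3])
  qed (use C assms in auto)
qed

text \<open>Summation over residue pairs. \<open>C\<close> is chosen before \<open>g\<close>, so
  that the estimate will hold uniformly over all shifts \<open>j\<close> and \<open>b\<close> that
  get built into \<open>g\<close>.\<close>

lemma card_periodic:
  fixes \<alpha> u v \<epsilon> :: real
  assumes \<alpha>: "0 < \<alpha>" "\<alpha> < 1" "\<alpha> \<notin> \<rat>" and uv: "0 \<le> u" "u \<le> v" "v \<le> 1" and "0 < \<epsilon>" and L: "0 < L"
  shows "\<exists>C\<ge>0. \<forall>N g. (\<forall>m a. g m a \<longleftrightarrow> g (m mod L) (a mod int L)) \<longrightarrow>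
      \<bar>real (card {m \<in> {1..<N}. g m \<lfloor>real m * \<alpha>\<rfloor> \<and> frac (real m * \<alpha>) \<in> {u<..<v}})
      - real (card {(r, s) \<in> {..<L} \<times> {0..<int L}. g r s}) / (real L)\<^sup>2 * (v - u) * real N\<bar> \<le> \<epsilon> * real N + C"
proof -
  define R where "R = {..<L} \<times> {0..<int L}"
  have R: "finite R" "card R = L\<^sup>2" unfolding R_def by (simp_all add: power2_eq_square)
  define P where "P rs N = {m \<in> {1..<N}. m mod L = fst rs \<and> \<lfloor>real m * \<alpha>\<rfloor> mod int L = snd rs \<and> frac (real m * \<alpha>) \<in> {u<..<v}}" for rs N
  have e: "0 < \<epsilon> / (real L)\<^sup>2" using assms by simp
  have "\<forall>rs\<in>R. \<exists>C\<ge>0. \<forall>N. \<bar>real (card (P rs N)) - real N * (v - u) / (real L)\<^sup>2\<bar> \<le> \<epsilon> / (real L)\<^sup>2 * real N + C"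
  proof
    fix rs assume "rs \<in> R"
    then have *: "fst rs < L" "0 \<le> snd rs" "snd rs < int L" unfolding R_def by auto
    show "\<exists>C\<ge>0. \<forall>N. \<bar>real (card (P rs N)) - real N * (v - u) / (real L)\<^sup>2\<bar> \<le> \<epsilon> / (real L)\<^sup>2 * real N + C"
      unfolding P_def using card_residue_class[OF \<alpha> uv e *] by blast
  qed
  from bchoice[OF this] obtain C where C: "\<And>rs. rs \<in> R \<Longrightarrow> 0 \<le> C rs"
    and bd: "\<And>rs N. rs \<in> R \<Longrightarrow> \<bar>real (card (P rs N)) - real N * (v - u) / (real L)\<^sup>2\<bar> \<le> \<epsilon> / (real L)\<^sup>2 * real N + C rs"
    by blast
  show ?thesis
  \<comment> \<open>Adding the constants over all of \<open>R\<close>, and not only over the pairs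
    satisfying \<open>g\<close>, makes the total independent of \<open>g\<close>.\<close>
  proof (intro exI[of _ "sum C R"] conjI allI impI)
    show "0 \<le> sum C R" using C by (rule sum_nonneg)
    fix N g assume g: "\<forall>m a. g m a \<longleftrightarrow> g (m mod L) (a mod int L)"
    let ?G = "{(r, s) \<in> R. g r s}"
    have G: "finite ?G" "?G \<subseteq> R" using R by (auto intro: finite_subset[of _ R])
    have "{m \<in> {1..<N}. g m \<lfloor>real m * \<alpha>\<rfloor> \<and> frac (real m * \<alpha>) \<in> {u<..<v}} = (\<Union>rs\<in>?G. P rs N)"
    proof -
      have "m \<in> (\<Union>rs\<in>?G. P rs N)" if "m \<in> {1..<N}" "g m \<lfloor>real m * \<alpha>\<rfloor>" "frac (real m * \<alpha>) \<in> {u<..<v}" for m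
        using that g[rule_format, of m] L unfolding P_def R_def
        by (intro UN_I[of "(m mod L, \<lfloor>real m * \<alpha>\<rfloor> mod int L)"]) auto
      moreover have "g m \<lfloor>real m * \<alpha>\<rfloor>" if "m \<in> (\<Union>rs\<in>?G. P rs N)" for m
        using that g[rule_format, of m "\<lfloor>real m * \<alpha>\<rfloor>"] unfolding P_def by auto
      ultimately show ?thesis unfolding P_def by blast
    qed
    then have "card {m \<in> {1..<N}. g m \<lfloor>real m * \<alpha>\<rfloor> \<and> frac (real m * \<alpha>) \<in> {u<..<v}} = (\<Sum>rs\<in>?G. card (P rs N))"
      using G(1) by (simp only:) (rule card_UN_disjoint, auto simp: P_def)
    then have "\<bar>real (card {m \<in> {1..<N}. g m \<lfloor>real m * \<alpha>\<rfloor> \<and> frac (real m * \<alpha>) \<in> {u<..<v}})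
        - real (card ?G) / (real L)\<^sup>2 * (v - u) * real N\<bar>
      = \<bar>\<Sum>rs\<in>?G. real (card (P rs N)) - real N * (v - u) / (real L)\<^sup>2\<bar>"
      by (simp add: sum_subtractf mult_ac)
    also have "\<dots> \<le> (\<Sum>rs\<in>?G. \<bar>real (card (P rs N)) - real N * (v - u) / (real L)\<^sup>2\<bar>)" by (rule sum_abs)
    also have "\<dots> \<le> (\<Sum>rs\<in>R. \<bar>real (card (P rs N)) - real N * (v - u) / (real L)\<^sup>2\<bar>)"
      using R G by (intro sum_mono2) auto
    also have "\<dots> \<le> (\<Sum>rs\<in>R. \<epsilon> / (real L)\<^sup>2 * real N + C rs)" by (rule sum_mono[OF bd])
    also have "\<dots> = \<epsilon> * real N + sum C R" using R L by (simp add: sum.distrib)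
    finally show "\<bar>real (card {m \<in> {1..<N}. g m \<lfloor>real m * \<alpha>\<rfloor> \<and> frac (real m * \<alpha>) \<in> {u<..<v}})
        - real (card {(r, s) \<in> {..<L} \<times> {0..<int L}. g r s}) / (real L)\<^sup>2 * (v - u) * real N\<bar> \<le> \<epsilon> * real N + sum C R"
      unfolding R_def .
  qed
qed

section \<open>Density of the sieved set\<close>

lemma frac_mult_pos:
  fixes \<alpha> :: real
  assumes "\<alpha> \<notin> \<rat>" "0 < m"
  shows "0 < frac (real m * \<alpha>)"
proof -
  have "real m * \<alpha> \<notin> \<int>"
  proof
    assume "real m * \<alpha> \<in> \<int>"
    then have "real m * \<alpha> / real m \<in> \<rat>" using Ints_subset_Rats by (intro Rats_divide) auto
    then show False using assms by simp
  qed
  then show ?thesis by (simp add: frac_gt_0_iff)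
qed

definition coprime_on :: "nat set \<Rightarrow> nat \<Rightarrow> int \<Rightarrow> bool" where
  "coprime_on S m a \<longleftrightarrow> (\<forall>p\<in>S. \<not> (p dvd m \<and> int p dvd a))"

text \<open>A further prime \<open>p\<close> removes exactly the \<open>m\<close> for which
  \<open>d * p\<close> divides both numbers, and \<open>1/d^2 - 1/(d*p)^2 = (1 - 1/p^2)/d^2\<close>.
  The modulus \<open>d\<close> is carried along so that the induction hypothesis also covers the
  removed part.\<close>

lemma coprime_on_density:
  fixes \<alpha> :: real
  assumes \<alpha>: "0 < \<alpha>" "\<alpha> < 1" "\<alpha> \<notin> \<rat>" and "finite S" "\<And>p. p \<in> S \<Longrightarrow> prime p" "0 < d" "\<And>p. p \<in> S \<Longrightarrow> coprime p d"
  shows "(\<lambda>N. real (card {m \<in> {1..<N}. d dvd m \<and> int d dvd \<lfloor>real m * \<alpha>\<rfloor> \<and> coprime_on S m \<lfloor>real m * \<alpha>\<rfloor>}) / real N)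
    \<longlonglongrightarrow> (\<Prod>p\<in>S. 1 - 1 / real p ^ 2) / real d ^ 2"
  using assms(4-)
proof (induction S arbitrary: d rule: finite_induct)
  case empty
  show ?case
  proof (rule LIMSEQ_I)
    fix e :: real assume e: "0 < e"
    obtain C where C: "0 \<le> C" and bd: "\<forall>N g. (\<forall>m a. g m a \<longleftrightarrow> g (m mod d) (a mod int d)) \<longrightarrow>
      \<bar>real (card {m \<in> {1..<N}. g m \<lfloor>real m * \<alpha>\<rfloor> \<and> frac (real m * \<alpha>) \<in> {0<..<1}})
      - real (card {(r, s) \<in> {..<d} \<times> {0..<int d}. g r s}) / (real d)\<^sup>2 * (1 - 0) * real N\<bar> \<le> e / 2 * real N + C"
      using card_periodic[OF \<alpha> order_refl zero_le_one order_refl half_gt_zero[OF e] empty(2)] by blast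
    have *: "\<bar>real (card {m \<in> {1..<N}. d dvd m \<and> int d dvd \<lfloor>real m * \<alpha>\<rfloor> \<and> coprime_on {} m \<lfloor>real m * \<alpha>\<rfloor>})
      - real N / (real d)\<^sup>2\<bar> \<le> e / 2 * real N + C" for N
    proof -
      have 1: "{(r, s) \<in> {..<d} \<times> {0..<int d}. d dvd r \<and> int d dvd s} = {(0, 0)}"
      proof -
        have "r = 0" if "d dvd r" "r < d" for r
          using that nat_dvd_not_less[of r d] by blast
        moreover have "s = 0" if "int d dvd s" "0 \<le> s" "s < int d" for s
          using that zdvd_not_zless[of s "int d"] by fastforce
        ultimately show ?thesis using empty(2) by auto
      qed
      \<comment> \<open>By irrationality every positive multiple of \<alpha> has its fractional part
        in the open unit interval, so that condition can be added freely.\<close>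
      have 2: "{m \<in> {1..<N}. d dvd m \<and> int d dvd \<lfloor>real m * \<alpha>\<rfloor> \<and> coprime_on {} m \<lfloor>real m * \<alpha>\<rfloor>}
        = {m \<in> {1..<N}. (d dvd m \<and> int d dvd \<lfloor>real m * \<alpha>\<rfloor>) \<and> frac (real m * \<alpha>) \<in> {0<..<1}}"
        using frac_mult_pos[OF \<alpha>(3)] frac_lt_1 by (auto simp: coprime_on_def)
      show ?thesis
        using bd[rule_format, of "\<lambda>m a. d dvd m \<and> int d dvd a" N] unfolding 1 2 by (simp add: dvd_mod_iff)
    qed
    obtain N0 :: nat where N0: "2 * C / e < real N0" using reals_Archimedean2 by blast
    show "\<exists>no. \<forall>N\<ge>no. norm (real (card {m \<in> {1..<N}. d dvd m \<and> int d dvd \<lfloor>real m * \<alpha>\<rfloor> \<and> coprime_on {} m \<lfloor>real m * \<alpha>\<rfloor>}) / real N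
       - (\<Prod>p\<in>{}. 1 - 1 / real p ^ 2) / real d ^ 2) < e"
    proof (intro exI[of _ "Suc N0"] allI impI)
      fix N assume N: "Suc N0 \<le> N"
      let ?x = "real (card {m \<in> {1..<N}. d dvd m \<and> int d dvd \<lfloor>real m * \<alpha>\<rfloor> \<and> coprime_on {} m \<lfloor>real m * \<alpha>\<rfloor>})"
      have Npos: "0 < real N" using N by simp
      have "C < e / 2 * real N"
      proof -
        have "2 * C / e < real N" using N N0 by simp
        then show ?thesis using e by (simp add: field_simps)
      qed
      then have "\<bar>?x - real N / (real d)\<^sup>2\<bar> < e * real N" using *[of N] by simp
      moreover have "\<bar>?x / real N - 1 / (real d)\<^sup>2\<bar> = \<bar>?x - real N / (real d)\<^sup>2\<bar> / real N"
      proof -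
        have "?x / real N - 1 / (real d)\<^sup>2 = (?x - real N / (real d)\<^sup>2) / real N"
          using Npos by (simp add: diff_divide_distrib)
        then show ?thesis by simp
      qed
      ultimately show "norm (?x / real N - (\<Prod>p\<in>{}. 1 - 1 / real p ^ 2) / real d ^ 2) < e"
        using Npos by (simp add: divide_less_eq)
    qed
  qed
next
  case (insert p S)
  let ?B = "\<lambda>d S N. {m \<in> {1..<N}. d dvd m \<and> int d dvd \<lfloor>real m * \<alpha>\<rfloor> \<and> coprime_on S m \<lfloor>real m * \<alpha>\<rfloor>}"
  have p: "prime p" "coprime p d" using insert.prems by auto
  have cop: "coprime q (d * p)" if "q \<in> S" for q
    using that insert primes_coprime[of q p] by auto
  have dv: "d * p dvd m \<longleftrightarrow> d dvd m \<and> p dvd m" for m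
    using p(2) by (auto simp: coprime_commute divides_mult intro: dvd_mult_left dvd_mult_right)
  have dvi: "int (d * p) dvd a \<longleftrightarrow> int d dvd a \<and> int p dvd a" for a
    using p(2) by (auto simp: coprime_commute divides_mult intro: dvd_mult_left dvd_mult_right)
  have "real (card (?B d (insert p S) N)) = real (card (?B d S N)) - real (card (?B (d * p) S N))" for N
  proof -
    have "?B d S N = ?B d (insert p S) N \<union> ?B (d * p) S N" "?B d (insert p S) N \<inter> ?B (d * p) S N = {}"
      unfolding dv dvi by (auto simp: coprime_on_def)
    then have "card (?B d S N) = card (?B d (insert p S) N) + card (?B (d * p) S N)"
      using card_Un_disjoint[of "?B d (insert p S) N" "?B (d * p) S N"] by simp
    then show ?thesis by simp
  qed
  moreover have "(\<lambda>N. real (card (?B d S N)) / real N - real (card (?B (d * p) S N)) / real N)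
    \<longlonglongrightarrow> (\<Prod>p\<in>S. 1 - 1 / real p ^ 2) / real d ^ 2 - (\<Prod>p\<in>S. 1 - 1 / real p ^ 2) / real (d * p) ^ 2"
    using insert.prems cop prime_gt_0_nat[OF p(1)] by (intro tendsto_diff insert.IH) auto
  moreover have "(\<Prod>p\<in>S. 1 - 1 / real p ^ 2) / real d ^ 2 - (\<Prod>p\<in>S. 1 - 1 / real p ^ 2) / real (d * p) ^ 2
    = (\<Prod>p\<in>insert p S. 1 - 1 / real p ^ 2) / real d ^ 2"
    using insert.hyps insert.prems(2) prime_gt_0_nat[OF p(1)] by (simp add: field_simps power_mult_distrib)
  ultimately show ?case by (simp only: diff_divide_distrib)
qed

text \<open>The sum of \<open>1 / p^2\<close> converges, so the infinite product is convergent and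
  its value is the limit of the partial products.\<close>

lemma prod_primes_tendsto_kappa:
  "(\<lambda>P. \<Prod>p\<in>{p. prime p \<and> p \<le> P}. 1 - 1 / real p ^ 2) \<longlonglongrightarrow> \<kappa>"
proof -
  define f :: "nat \<Rightarrow> real" where "f p = (if prime p then 1 - 1 / real p ^ 2 else 1)" for p
  have "summable (\<lambda>p. norm (f p - 1))"
  proof (rule summable_comparison_test)
    show "summable (\<lambda>p. inverse (real p ^ 2))" by (rule inverse_power_summable) simp
    show "\<exists>N. \<forall>p\<ge>N. norm (norm (f p - 1)) \<le> inverse (real p ^ 2)"
      by (intro exI[of _ 0]) (auto simp: f_def divide_inverse)
  qed
  then have "convergent_prod f"
    using summable_imp_convergent_prod_real summable_imp_abs_convergent_prod abs_convergent_prod_imp_convergent_prod by blast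
  then have "(\<lambda>P. \<Prod>p\<le>P. f p) \<longlonglongrightarrow> prodinf f" by (rule convergent_prod_LIMSEQ)
  moreover have "(\<Prod>p\<le>P. f p) = (\<Prod>p\<in>{p. prime p \<and> p \<le> P}. 1 - 1 / real p ^ 2)" for P
    unfolding f_def by (subst prod.inter_filter[symmetric]) (auto intro!: prod.cong)
  ultimately show ?thesis unfolding \<kappa>_def f_def by simp
qed

section \<open>Neighbourhoods of orbit points\<close>

text \<open>Inclusion-exclusion stops at pairs. When the largest index \<open>s\<close> is added,
  the pieces of \<open>B s\<close> covered by earlier sets are pairwise disjoint, because no three
  sets meet, so their measures add up.\<close>

lemma measure_UN_at_most_double:
  fixes B :: "nat \<Rightarrow> 'a set"
  assumes "finite I" "\<And>i. i \<in> I \<Longrightarrow> B i \<in> fmeasurable M"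
    and "\<And>i j k. i \<in> I \<Longrightarrow> j \<in> I \<Longrightarrow> k \<in> I \<Longrightarrow> i < j \<Longrightarrow> j < k \<Longrightarrow> B i \<inter> B j \<inter> B k = {}"
  shows "measure M (\<Union>i\<in>I. B i) =
    (\<Sum>i\<in>I. measure M (B i)) - (\<Sum>k\<in>I. \<Sum>i\<in>{i \<in> I. i < k}. measure M (B i \<inter> B k))"
  using assms
proof (induction I rule: finite_linorder_max_induct)
  case (insert s I)
  then have s: "s \<notin> I" "\<And>i. i \<in> I \<Longrightarrow> i < s" by auto
  have fm: "B i \<in> fmeasurable M" if "i \<in> insert s I" for i using insert that by blast
  have "measure M (\<Union>i\<in>insert s I. B i) = measure M (B s \<union> (\<Union>i\<in>I. B i))" by simp
  also have "\<dots> = measure M (B s) + measure M (\<Union>i\<in>I. B i) - measure M (B s \<inter> (\<Union>i\<in>I. B i))"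
    using fm insert.hyps(1) by (intro measure_Un3 fmeasurable.finite_UN) auto
  finally have union: "measure M (\<Union>i\<in>insert s I. B i)
    = measure M (B s) + measure M (\<Union>i\<in>I. B i) - measure M (B s \<inter> (\<Union>i\<in>I. B i))" .
  have IH: "measure M (\<Union>i\<in>I. B i) =
    (\<Sum>i\<in>I. measure M (B i)) - (\<Sum>k\<in>I. \<Sum>i\<in>{i \<in> I. i < k}. measure M (B i \<inter> B k))"
    using insert.prems by (intro insert.IH) blast+
  have "measure M (B s \<inter> (\<Union>i\<in>I. B i)) = measure M (\<Union>i\<in>I. B i \<inter> B s)"
    by (rule arg_cong[of _ _ "measure M"]) blast
  also have "\<dots> = (\<Sum>i\<in>I. measure M (B i \<inter> B s))"
  proof (rule measure_UNION')
    show "pairwise (\<lambda>i j. disjnt (B i \<inter> B s) (B j \<inter> B s)) I"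
    proof (rule pairwiseI)
      fix i j assume ij: "i \<in> I" "j \<in> I" "i \<noteq> j"
      show "disjnt (B i \<inter> B s) (B j \<inter> B s)"
      proof (cases "i < j")
        case True
        then have "B i \<inter> B j \<inter> B s = {}" using ij s by (intro insert.prems(2)) auto
        then show ?thesis by (auto simp: disjnt_def)
      next
        case False
        then have "B j \<inter> B i \<inter> B s = {}" using ij s by (intro insert.prems(2)) auto
        then show ?thesis by (auto simp: disjnt_def)
      qed
    qed
  qed (use fm insert.hyps in \<open>auto intro: fmeasurable.Int\<close>)
  finally have inter: "measure M (B s \<inter> (\<Union>i\<in>I. B i)) = (\<Sum>i\<in>I. measure M (B i \<inter> B s))" .
  have double: "(\<Sum>k\<in>insert s I. \<Sum>i\<in>{i \<in> insert s I. i < k}. measure M (B i \<inter> B k)) =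
    (\<Sum>i\<in>I. measure M (B i \<inter> B s)) + (\<Sum>k\<in>I. \<Sum>i\<in>{i \<in> I. i < k}. measure M (B i \<inter> B k))"
  proof -
    have "{i \<in> insert s I. i < s} = I" using s by auto
    moreover have "{i \<in> insert s I. i < k} = {i \<in> I. i < k}" if "k \<in> I" for k using s(2)[OF that] by auto
    ultimately show ?thesis using insert.hyps(1) s(1) by simp
  qed
  have "(\<Sum>i\<in>insert s I. measure M (B i)) = measure M (B s) + (\<Sum>i\<in>I. measure M (B i))"
    using insert.hyps(1) s(1) by simp
  then show ?case unfolding union IH inter double by linarith
qed simp

text \<open>Whether two neighbourhoods meet is governed by how close \<open>j * \<alpha>\<close> is
  to an integer, with \<open>j\<close> the difference of their indices; sorted by \<open>j\<close>,
  few groups of pairs contribute.\<close>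

lemma sum_pairs_by_difference:
  fixes f :: "nat \<Rightarrow> nat \<Rightarrow> 'b::comm_monoid_add"
  assumes "M \<subseteq> {1..<Q}"
  shows "(\<Sum>s\<in>M. \<Sum>m\<in>{m \<in> M. m < s}. f m s) =
    (\<Sum>j\<in>{1..<Q}. \<Sum>m\<in>{1..<Q - j}. if m \<in> M \<and> m + j \<in> M then f m (m + j) else 0)"
proof -
  have M: "finite M" using assms by (rule finite_subset) simp
  have "(\<Sum>s\<in>M. \<Sum>m\<in>{m \<in> M. m < s}. f m s) = (\<Sum>(s, m)\<in>(SIGMA s:M. {m \<in> M. m < s}). f m s)"
    using M by (subst sum.Sigma) auto
  also have "\<dots> = (\<Sum>(j, m)\<in>(SIGMA j:{1..<Q}. {m \<in> {1..<Q - j}. m \<in> M \<and> m + j \<in> M}). f m (m + j))"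
    using assms by (intro sum.reindex_bij_witness[of _ "\<lambda>(j, m). (m + j, m)" "\<lambda>(s, m). (s - m, m)"]) force+
  also have "\<dots> = (\<Sum>j\<in>{1..<Q}. \<Sum>m\<in>{m \<in> {1..<Q - j}. m \<in> M \<and> m + j \<in> M}. f m (m + j))"
    by (subst sum.Sigma) auto
  also have "\<dots> = (\<Sum>j\<in>{1..<Q}. \<Sum>m\<in>{1..<Q - j}. if m \<in> M \<and> m + j \<in> M then f m (m + j) else 0)"
    by (intro sum.cong refl sum.inter_filter) simp
  finally show ?thesis .
qed

text \<open>Pigeonhole: three half-open cells of length \<sigma> cover the interval and each holds
  at most one value. It bounds both the close differences and the orbit points near an
  endpoint.\<close>

lemma card_separated_le_3:
  fixes f :: "nat \<Rightarrow> real"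
  assumes "0 < \<sigma>" and sep: "\<And>i j. i \<in> X \<Longrightarrow> j \<in> X \<Longrightarrow> i \<noteq> j \<Longrightarrow> \<sigma> \<le> \<bar>f i - f j\<bar>"
    and "\<And>i. i \<in> X \<Longrightarrow> f i \<in> {c - 2 * \<delta>..c + 2 * \<delta>}" and "4 * \<delta> < 3 * \<sigma>"
  shows "card X \<le> 3"
proof -
  define g where "g i = \<lfloor>(f i - (c - 2 * \<delta>)) / \<sigma>\<rfloor>" for i
  have "inj_on g X"
  proof (rule inj_onI, rule ccontr)
    fix i j assume ij: "i \<in> X" "j \<in> X" "g i = g j" "i \<noteq> j"
    then have "\<bar>(f i - (c - 2 * \<delta>)) / \<sigma> - (f j - (c - 2 * \<delta>)) / \<sigma>\<bar> < 1"
      unfolding g_def by linarith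
    then have "\<bar>(f i - f j) / \<sigma>\<bar> < 1" by (simp add: diff_divide_distrib)
    then have "\<bar>f i - f j\<bar> < \<sigma>" using assms(1) by (simp add: abs_divide)
    then show False using sep[OF ij(1,2,4)] by linarith
  qed
  moreover have "g ` X \<subseteq> {0..2}"
  proof (rule image_subsetI)
    fix i assume "i \<in> X"
    from assms(3)[OF this] assms(4)
    have "0 \<le> f i - (c - 2 * \<delta>)" "f i - (c - 2 * \<delta>) < 3 * \<sigma>" by auto
    then have "0 \<le> (f i - (c - 2 * \<delta>)) / \<sigma>" "(f i - (c - 2 * \<delta>)) / \<sigma> < 3"
      using assms(1) by (auto simp: divide_less_eq)
    then show "g i \<in> {0..2}" unfolding g_def by simp
  qed
  ultimately have "card X \<le> card {0..2::int}" by (intro card_inj_on_le) auto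
  then show ?thesis by simp
qed

section \<open>Intervals around a marked part of the orbit\<close>

context
  fixes \<alpha> \<delta> :: real and Q :: nat and G :: "nat \<Rightarrow> int \<Rightarrow> bool"
begin

abbreviation (input) orbit_point :: "nat \<Rightarrow> real" where
  "orbit_point m \<equiv> frac (real m * \<alpha>)"

abbreviation (input) orbit_nbhd :: "nat \<Rightarrow> real set" where
  "orbit_nbhd m \<equiv> {orbit_point m - \<delta><..<orbit_point m + \<delta>}"

definition marked :: "nat set" where
  "marked = {m \<in> {1..<Q}. G m \<lfloor>real m * \<alpha>\<rfloor>}"

text \<open>At \<open>j = 0\<close> the two intervals coincide and single lengths are summed, so one
  estimate serves singles and pairs.\<close>

definition overlap_sum :: "nat \<Rightarrow> real \<Rightarrow> real \<Rightarrow> real" where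
  "overlap_sum j u v = (\<Sum>m\<in>{1..<Q - j}. if m \<in> marked \<and> m + j \<in> marked
     then measure lebesgue (orbit_nbhd m \<inter> orbit_nbhd (m + j) \<inter> {u<..<v}) else 0)"

text \<open>The integer part of \<open>(m + j) * \<alpha>\<close> is replaced by that of
  \<open>m * \<alpha>\<close> plus \<open>b\<close>. For \<open>b\<close> close to
  \<open>j * \<alpha>\<close> the two agree away from the ends of the unit interval, and the
  condition now involves only \<open>m\<close> and
  \<open>\<lfloor>real m * \<alpha>\<rfloor>\<close>.\<close>

definition pair_count :: "nat \<Rightarrow> int \<Rightarrow> real \<Rightarrow> real \<Rightarrow> real" where
  "pair_count j b u v = real (card {m \<in> {1..<Q - j}.
     (G m \<lfloor>real m * \<alpha>\<rfloor> \<and> G (m + j) (\<lfloor>real m * \<alpha>\<rfloor> + b)) \<and> orbit_point m \<in> {u<..<v}})"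

context
  assumes sep: "\<And>j b. 0 < j \<Longrightarrow> j < Q \<Longrightarrow> 1 / (2 * real Q) < \<bar>real j * \<alpha> - of_int b\<bar>"
    and \<delta>: "0 < \<delta>" "3 * \<delta> * real Q < 1" and Q: "0 < Q"
begin

text \<open>With \<sigma> = \<open>1 / (2 * Q)\<close>, the bound on \<delta> reads
  \<open>3 * \<delta> < 2 * \<sigma>\<close>. The first form feeds the pigeonhole counts, the second
  the containment and triple-intersection arguments.\<close>

lemma \<delta>_less_sep: "4 * \<delta> < 3 * (1 / (2 * real Q))" "6 * \<delta> < 4 * (1 / (2 * real Q))"
proof -
  have "3 * \<delta> < 1 / real Q" using \<delta> Q by (simp add: field_simps)
  moreover have "1 / (2 * real Q) = 1 / real Q / 2" by simp
  ultimately show "4 * \<delta> < 3 * (1 / (2 * real Q))" "6 * \<delta> < 4 * (1 / (2 * real Q))"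
    using \<delta>(1) by linarith+
qed

lemma orbit_point_sep:
  assumes "m < Q" "m' < Q" "m \<noteq> m'"
  shows "1 / (2 * real Q) < \<bar>orbit_point m - orbit_point m'\<bar>"
proof -
  have *: "1 / (2 * real Q) < \<bar>orbit_point m - orbit_point m'\<bar>" if "m' < m" "m < Q" for m m'
    using that sep[of "m - m'" "\<lfloor>real m * \<alpha>\<rfloor> - \<lfloor>real m' * \<alpha>\<rfloor>"]
    by (simp add: frac_def of_nat_diff algebra_simps)
  show ?thesis
    using *[of m' m] *[of m m'] assms by (cases "m' < m") (auto simp: abs_minus_commute)
qed

lemma orbit_point_bounds:
  assumes "0 < m" "m < Q"
  shows "1 / (2 * real Q) < orbit_point m" "orbit_point m < 1 - 1 / (2 * real Q)"
proof -
  have "\<bar>real m * \<alpha> - of_int \<lfloor>real m * \<alpha>\<rfloor>\<bar> = orbit_point m"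
    "\<bar>real m * \<alpha> - of_int (\<lfloor>real m * \<alpha>\<rfloor> + 1)\<bar> = 1 - orbit_point m"
    using frac_ge_0[of "real m * \<alpha>"] frac_lt_1[of "real m * \<alpha>"] unfolding frac_def by simp_all
  then show "1 / (2 * real Q) < orbit_point m" "orbit_point m < 1 - 1 / (2 * real Q)"
    using sep[OF assms, of "\<lfloor>real m * \<alpha>\<rfloor>"] sep[OF assms, of "\<lfloor>real m * \<alpha>\<rfloor> + 1"] by linarith+
qed

text \<open>The centres stay farther than \<delta> from 0 and 1, so no interval wraps around modulo
  1.\<close>

lemma orbit_nbhd_subset:
  assumes "0 < m" "m < Q"
  shows "orbit_nbhd m \<subseteq> {0<..<1}"
proof
  fix y assume "y \<in> orbit_nbhd m"
  then show "y \<in> {0<..<1}"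
    using orbit_point_bounds[OF assms] \<delta>_less_sep(2) \<delta>(1)
    unfolding greaterThanLessThan_iff by linarith
qed

text \<open>A common point would put three centres within a span below \<open>2 * \<delta>\<close>,
  but pairwise separation spreads them over more than \<open>1 / Q\<close>.\<close>

lemma orbit_nbhd_no_triple:
  assumes "a < b" "b < c" "c < Q"
  shows "orbit_nbhd a \<inter> orbit_nbhd b \<inter> orbit_nbhd c = {}"
proof -
  have "1 / (2 * real Q) < \<bar>orbit_point a - orbit_point b\<bar>" "1 / (2 * real Q) < \<bar>orbit_point b - orbit_point c\<bar>"
    "1 / (2 * real Q) < \<bar>orbit_point a - orbit_point c\<bar>"
    using assms by (auto intro!: orbit_point_sep)
  moreover have False if "\<bar>x - y\<bar> < \<delta>" "\<bar>x' - y\<bar> < \<delta>" "\<bar>x'' - y\<bar> < \<delta>" "\<sigma> < \<bar>x - x'\<bar>" "\<sigma> < \<bar>x' - x''\<bar>" "\<sigma> < \<bar>x - x''\<bar>"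
    "6 * \<delta> < 4 * \<sigma>" for x x' x'' y \<sigma> using that by (auto simp: abs_if split: if_splits)
  ultimately show ?thesis using \<delta>_less_sep(2) by (fastforce simp: abs_less_iff)
qed

text \<open>The signed distances \<open>j * \<alpha> - b\<close> are themselves separated, since two
  of them differ by such a distance for the index \<open>i - j\<close>; the pigeonhole bound
  applies.\<close>

lemma card_close_differences: "card {j \<in> {1..<Q}. \<exists>b. \<bar>real j * \<alpha> - of_int b\<bar> < 2 * \<delta>} \<le> 3"
proof -
  let ?S = "{j \<in> {1..<Q}. \<exists>b. \<bar>real j * \<alpha> - of_int b\<bar> < 2 * \<delta>}"
  have "\<forall>j\<in>?S. \<exists>b::int. \<bar>real j * \<alpha> - of_int b\<bar> < 2 * \<delta>" by blast
  from bchoice[OF this] obtain b :: "nat \<Rightarrow> int" where b: "\<And>j. j \<in> ?S \<Longrightarrow> \<bar>real j * \<alpha> - of_int (b j)\<bar> < 2 * \<delta>"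
    by blast
  have *: "1 / (2 * real Q) \<le> \<bar>(real i * \<alpha> - of_int (b i)) - (real j * \<alpha> - of_int (b j))\<bar>" if "j < i" "i < Q" for i j
  proof -
    have "i - j < Q" "0 < i - j" using that by auto
    from sep[OF this(2,1), of "b i - b j"] show ?thesis
      using that by (simp add: of_nat_diff algebra_simps)
  qed
  show ?thesis
  proof (rule card_separated_le_3[of "1 / (2 * real Q)" _ "\<lambda>j. real j * \<alpha> - of_int (b j)" 0 \<delta>])
    show "1 / (2 * real Q) \<le> \<bar>(real i * \<alpha> - of_int (b i)) - (real j * \<alpha> - of_int (b j))\<bar>"
      if "i \<in> ?S" "j \<in> ?S" "i \<noteq> j" for i j
      using *[of i j] *[of j i] that by (cases "j < i") (auto simp: abs_minus_commute)
    show "real i * \<alpha> - of_int (b i) \<in> {0 - 2 * \<delta>..0 + 2 * \<delta>}" if "i \<in> ?S" for i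
      using b[OF that] by auto
  qed (use \<delta>_less_sep Q in auto)
qed

text \<open>Well inside the window every admissible pair overlaps in the same length; well outside
  both terms vanish. Errors come only from points within \<open>2 * \<delta>\<close> of
  \<open>u\<close> or \<open>v\<close>: at most three each, each costing at most
  \<open>2 * \<delta>\<close>.\<close>

lemma overlap_sum_approx:
  assumes j: "j < Q" and b: "\<bar>real j * \<alpha> - of_int b\<bar> < 2 * \<delta>" and uv: "0 \<le> u" "u \<le> v" "v \<le> 1"
  shows "\<bar>overlap_sum j u v - (2 * \<delta> - \<bar>real j * \<alpha> - of_int b\<bar>) * pair_count j b u v\<bar> \<le> 12 * \<delta>"
proof -
  define \<theta> w where "\<theta> = real j * \<alpha> - of_int b" and "w = 2 * \<delta> - \<bar>\<theta>\<bar>"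
  have \<theta>: "\<bar>\<theta>\<bar> < 2 * \<delta>" using b unfolding \<theta>_def .
  have w: "0 \<le> w" "w \<le> 2 * \<delta>" unfolding w_def using \<theta> by auto
  define near where "near c = {m \<in> {1..<Q - j}. orbit_point m \<in> {c - 2 * \<delta>..c + 2 * \<delta>}}" for c
  have near: "card (near c) \<le> 3" for c
    unfolding near_def
    by (rule card_separated_le_3[of "1 / (2 * real Q)" _ orbit_point c \<delta>])
      (use Q \<delta>_less_sep in \<open>auto intro!: less_imp_le[OF orbit_point_sep]\<close>)
  define \<mu> where "\<mu> m = measure lebesgue (orbit_nbhd m \<inter> orbit_nbhd (m + j) \<inter> {u<..<v})" for m
  define t where "t m = (if m \<in> marked \<and> m + j \<in> marked then \<mu> m else 0)" for m
  define i where "i m = (if (G m \<lfloor>real m * \<alpha>\<rfloor> \<and> G (m + j) (\<lfloor>real m * \<alpha>\<rfloor> + b)) \<and> orbit_point m \<in> {u<..<v}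
    then w else 0)" for m
  have "0 \<le> \<mu> m \<and> \<mu> m \<le> 2 * \<delta>" for m
  proof -
    have "\<mu> m \<le> measure lebesgue (orbit_nbhd m)"
      unfolding \<mu>_def
    proof (rule measure_mono_fmeasurable)
      show "orbit_nbhd m \<inter> orbit_nbhd (m + j) \<inter> {u<..<v} \<subseteq> orbit_nbhd m" by blast
      show "orbit_nbhd m \<inter> orbit_nbhd (m + j) \<inter> {u<..<v} \<in> sets lebesgue"
        by (intro fmeasurableD fmeasurable.Int lmeasurable_interval)
    qed (rule lmeasurable_interval)
    moreover have "measure lebesgue (orbit_nbhd m) = 2 * \<delta>" using \<delta> by simp
    moreover have "0 \<le> \<mu> m" unfolding \<mu>_def by (rule measure_nonneg)
    ultimately show ?thesis by linarith
  qed
  then have t: "0 \<le> t m \<and> t m \<le> 2 * \<delta>" for m unfolding t_def using \<delta>(1) by simp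
  have i: "0 \<le> i m \<and> i m \<le> 2 * \<delta>" for m unfolding i_def using w \<delta>(1) by simp
  have far: "t m = i m" if m: "m \<in> {1..<Q - j}" "m \<notin> near u \<union> near v" for m
  proof (cases "u + 2 * \<delta> < orbit_point m \<and> orbit_point m < v - 2 * \<delta>")
    case True
    have e: "real (m + j) * \<alpha> = of_int (\<lfloor>real m * \<alpha>\<rfloor> + b) + (orbit_point m + \<theta>)"
      unfolding \<theta>_def frac_def by (simp add: algebra_simps)
    \<comment> \<open>The distance to \<open>u\<close> and \<open>v\<close> exceeds
      \<open>2 * \<delta>\<close>, hence the shift \<theta>, so adding it causes no carry into the
      integer part.\<close>
    have bd: "0 \<le> orbit_point m + \<theta>" "orbit_point m + \<theta> < 1" using True \<theta> uv by linarith+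
    have fl: "\<lfloor>real (m + j) * \<alpha>\<rfloor> = \<lfloor>real m * \<alpha>\<rfloor> + b"
      unfolding e using bd by (intro floor_unique) auto
    then have fr: "orbit_point (m + j) = orbit_point m + \<theta>"
      unfolding frac_def[of "real (m + j) * \<alpha>"] by (subst e) simp
    have set: "orbit_nbhd m \<inter> orbit_nbhd (m + j) \<inter> {u<..<v}
      = {orbit_point m + max 0 \<theta> - \<delta><..<orbit_point m + min 0 \<theta> + \<delta>}"
      unfolding fr using True \<delta> by auto
    have "\<mu> m = w"
      unfolding \<mu>_def set w_def using \<theta> by (auto simp: max_def min_def)
    moreover have "m \<in> marked \<and> m + j \<in> marked \<longleftrightarrow> G m \<lfloor>real m * \<alpha>\<rfloor> \<and> G (m + j) (\<lfloor>real m * \<alpha>\<rfloor> + b)"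
      using m unfolding marked_def by (auto simp only: mem_Collect_eq fl atLeastLessThan_iff)
    moreover have "orbit_point m \<in> {u<..<v}" using True \<delta>(1) by simp
    ultimately show ?thesis unfolding t_def i_def by simp
  next
    case False
    moreover have "orbit_point m \<notin> {u - 2 * \<delta>..u + 2 * \<delta>}" "orbit_point m \<notin> {v - 2 * \<delta>..v + 2 * \<delta>}"
      using m unfolding near_def by blast+
    ultimately have out: "orbit_point m < u - 2 * \<delta> \<or> v + 2 * \<delta> < orbit_point m"
      using uv unfolding atLeastAtMost_iff by linarith
    then have "orbit_point m \<notin> {u<..<v}" using \<delta>(1) unfolding greaterThanLessThan_iff by linarith
    moreover have "orbit_nbhd m \<inter> orbit_nbhd (m + j) \<inter> {u<..<v} = {}"
    proof (rule equals0I)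
      fix y assume "y \<in> orbit_nbhd m \<inter> orbit_nbhd (m + j) \<inter> {u<..<v}"
      then show False using out \<delta>(1) unfolding Int_iff greaterThanLessThan_iff by linarith
    qed
    ultimately show ?thesis unfolding t_def i_def \<mu>_def by (simp only: measure_empty if_cancel simp_thms if_False)
  qed
  have "overlap_sum j u v - w * pair_count j b u v = (\<Sum>m\<in>{1..<Q - j}. t m - i m)"
  proof -
    have "(\<Sum>m\<in>{1..<Q - j}. i m) = w * pair_count j b u v"
      unfolding i_def pair_count_def by (subst sum.inter_filter[symmetric]) (auto simp: mult.commute)
    moreover have "overlap_sum j u v = (\<Sum>m\<in>{1..<Q - j}. t m)"
      unfolding overlap_sum_def t_def \<mu>_def ..
    ultimately show ?thesis by (simp only: sum_subtractf)
  qed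
  also have "\<bar>\<dots>\<bar> \<le> (\<Sum>m\<in>{1..<Q - j}. \<bar>t m - i m\<bar>)" by (rule sum_abs)
  also have "\<dots> = (\<Sum>m\<in>near u \<union> near v. \<bar>t m - i m\<bar>)"
    using far by (intro sum.mono_neutral_right) (auto simp: near_def)
  also have "\<dots> \<le> (\<Sum>m\<in>near u \<union> near v. 2 * \<delta>)"
  proof (rule sum_mono)
    fix m show "\<bar>t m - i m\<bar> \<le> 2 * \<delta>" using t[of m] i[of m] by linarith
  qed
  also have "\<dots> \<le> 6 * (2 * \<delta>)"
  proof -
    have "card (near u \<union> near v) \<le> 6" using card_Un_le[of "near u" "near v"] near[of u] near[of v] by linarith
    then have "real (card (near u \<union> near v)) \<le> 6" by simp
    then show ?thesis using \<delta> by simp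
  qed
  also have "6 * (2 * \<delta>) = 12 * \<delta>" by simp
  finally show ?thesis unfolding w_def \<theta>_def .
qed

text \<open>Inclusion-exclusion with pairs grouped by difference. Intervals that meet have centres
  less than \<open>2 * \<delta>\<close> apart, so only differences \<open>j\<close> with
  \<open>j * \<alpha>\<close> that close to an integer survive.\<close>

lemma measure_marked_nbhds:
  "measure lebesgue ((\<Union>m\<in>marked. orbit_nbhd m) \<inter> {u<..<v})
    = overlap_sum 0 u v - (\<Sum>j | j \<in> {1..<Q} \<and> (\<exists>b. \<bar>real j * \<alpha> - of_int b\<bar> < 2 * \<delta>). overlap_sum j u v)"
proof -
  have M: "finite marked" "marked \<subseteq> {1..<Q}" unfolding marked_def by auto
  let ?B = "\<lambda>m. orbit_nbhd m \<inter> {u<..<v}"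
  have zero: "overlap_sum j u v = 0" if j: "j \<in> {1..<Q}" "\<nexists>b. \<bar>real j * \<alpha> - of_int b\<bar> < 2 * \<delta>" for j
  proof -
    have "orbit_nbhd m \<inter> orbit_nbhd (m + j) \<inter> {u<..<v} = {}" for m
    proof (rule ccontr)
      assume "orbit_nbhd m \<inter> orbit_nbhd (m + j) \<inter> {u<..<v} \<noteq> {}"
      then have "\<bar>orbit_point (m + j) - orbit_point m\<bar> < 2 * \<delta>" by auto
      moreover have "orbit_point (m + j) - orbit_point m
        = real j * \<alpha> - of_int (\<lfloor>real (m + j) * \<alpha>\<rfloor> - \<lfloor>real m * \<alpha>\<rfloor>)"
        unfolding frac_def by (simp add: algebra_simps)
      ultimately show False using j(2) by metis
    qed
    then show ?thesis unfolding overlap_sum_def by (simp only: measure_empty if_cancel sum.neutral_const)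
  qed
  have union: "measure lebesgue (\<Union>m\<in>marked. ?B m) = (\<Sum>m\<in>marked. measure lebesgue (?B m))
    - (\<Sum>k\<in>marked. \<Sum>m\<in>{m \<in> marked. m < k}. measure lebesgue (?B m \<inter> ?B k))"
  proof (rule measure_UN_at_most_double[OF M(1)])
    show "?B m \<in> lmeasurable" for m by (intro fmeasurable.Int lmeasurable_interval)
    show "?B i \<inter> ?B j \<inter> ?B k = {}" if "k \<in> marked" "i < j" "j < k" for i j k
    proof -
      have "k < Q" using that(1) M(2) by auto
      then show ?thesis using orbit_nbhd_no_triple[OF that(2,3)] by blast
    qed
  qed
  have single: "(\<Sum>m\<in>marked. measure lebesgue (?B m)) = overlap_sum 0 u v"
  proof -
    have "(\<Sum>m\<in>marked. measure lebesgue (?B m)) = (\<Sum>m\<in>{m \<in> {1..<Q}. m \<in> marked}. measure lebesgue (?B m))"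
      using M(2) by (intro sum.cong) auto
    also have "\<dots> = (\<Sum>m\<in>{1..<Q}. if m \<in> marked then measure lebesgue (?B m) else 0)"
      by (intro sum.inter_filter) simp
    finally show ?thesis
      unfolding overlap_sum_def by (simp only: add_0_right diff_zero conj_absorb Int_absorb)
  qed
  have "(\<Sum>k\<in>marked. \<Sum>m\<in>{m \<in> marked. m < k}. measure lebesgue (?B m \<inter> ?B k)) = (\<Sum>j\<in>{1..<Q}. overlap_sum j u v)"
  proof -
    have "?B m \<inter> ?B k = orbit_nbhd m \<inter> orbit_nbhd k \<inter> {u<..<v}" for m k by blast
    then show ?thesis unfolding overlap_sum_def sum_pairs_by_difference[OF M(2)] by (simp only:)
  qed
  also have "\<dots> = (\<Sum>j | j \<in> {1..<Q} \<and> (\<exists>b. \<bar>real j * \<alpha> - of_int b\<bar> < 2 * \<delta>). overlap_sum j u v)"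
    using zero by (intro sum.mono_neutral_right) auto
  finally show ?thesis using union single by (simp only: Int_UN_distrib2 UN_extend_simps)
qed

text \<open>Four differences matter: 0 and at most three close ones. Each contributes
  \<open>12 * \<delta>\<close> for either window and \<open>2 * \<delta> * E\<close> for the pair
  counts.\<close>

lemma marked_nbhds_discrepancy:
  assumes E: "\<And>j b. j < Q \<Longrightarrow> \<bar>pair_count j b u v - (v - u) * pair_count j b 0 1\<bar> \<le> E"
    and uv: "0 \<le> u" "u \<le> v" "v \<le> 1"
  shows "\<bar>measure lebesgue ((\<Union>m\<in>marked. orbit_nbhd m) \<inter> {u<..<v})
    - (v - u) * measure lebesgue (\<Union>m\<in>marked. orbit_nbhd m)\<bar> \<le> 96 * \<delta> + 8 * \<delta> * E"
proof -
  let ?S = "{j. j \<in> {1..<Q} \<and> (\<exists>b. \<bar>real j * \<alpha> - of_int b\<bar> < 2 * \<delta>)}"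
  define D where "D j = overlap_sum j u v - (v - u) * overlap_sum j 0 1" for j
  have D: "\<bar>D j\<bar> \<le> 24 * \<delta> + 2 * \<delta> * E" if j: "j < Q" "\<bar>real j * \<alpha> - of_int b\<bar> < 2 * \<delta>" for j b
  proof -
    let ?w = "2 * \<delta> - \<bar>real j * \<alpha> - of_int b\<bar>"
    have w: "0 \<le> ?w" "?w \<le> 2 * \<delta>" using j by auto
    have 1: "\<bar>overlap_sum j u v - ?w * pair_count j b u v\<bar> \<le> 12 * \<delta>"
      by (rule overlap_sum_approx[OF j uv])
    have "\<bar>overlap_sum j 0 1 - ?w * pair_count j b 0 1\<bar> \<le> 12 * \<delta>"
      by (rule overlap_sum_approx[OF j]) auto
    then have "\<bar>(v - u) * (overlap_sum j 0 1 - ?w * pair_count j b 0 1)\<bar> \<le> 1 * (12 * \<delta>)"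
      unfolding abs_mult using uv by (intro mult_mono) auto
    then have 2: "\<bar>(v - u) * overlap_sum j 0 1 - ?w * ((v - u) * pair_count j b 0 1)\<bar> \<le> 12 * \<delta>"
      by (simp add: algebra_simps)
    have "\<bar>?w * (pair_count j b u v - (v - u) * pair_count j b 0 1)\<bar> \<le> 2 * \<delta> * E"
      unfolding abs_mult using w E[OF j(1)] \<delta> by (intro mult_mono) auto
    then have 3: "\<bar>?w * pair_count j b u v - ?w * ((v - u) * pair_count j b 0 1)\<bar> \<le> 2 * \<delta> * E"
      by (simp only: right_diff_distrib)
    have "\<bar>x - x'\<bar> \<le> 12 * \<delta> \<Longrightarrow> \<bar>y - y'\<bar> \<le> 12 * \<delta> \<Longrightarrow> \<bar>x' - y'\<bar> \<le> 2 * \<delta> * E \<Longrightarrow> \<bar>x - y\<bar> \<le> 24 * \<delta> + 2 * \<delta> * E"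
      for x x' y y' by linarith
    from this[OF 1 2 3] show ?thesis unfolding D_def .
  qed
  have "(\<Union>m\<in>marked. orbit_nbhd m) = (\<Union>m\<in>marked. orbit_nbhd m) \<inter> {0<..<1}"
  proof -
    have "orbit_nbhd m \<subseteq> {0<..<1}" if "m \<in> marked" for m
      using orbit_nbhd_subset[of m] that unfolding marked_def by simp
    then show ?thesis by blast
  qed
  then have "measure lebesgue (\<Union>m\<in>marked. orbit_nbhd m) = overlap_sum 0 0 1 - (\<Sum>j\<in>?S. overlap_sum j 0 1)"
    using measure_marked_nbhds[of 0 1] by (simp only:)
  then have full: "measure lebesgue ((\<Union>m\<in>marked. orbit_nbhd m) \<inter> {u<..<v})
    - (v - u) * measure lebesgue (\<Union>m\<in>marked. orbit_nbhd m) = D 0 - (\<Sum>j\<in>?S. D j)"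
    unfolding measure_marked_nbhds D_def by (simp only: sum_subtractf sum_distrib_left[symmetric] right_diff_distrib)
  have "\<bar>D 0 - (\<Sum>j\<in>?S. D j)\<bar> \<le> \<bar>D 0\<bar> + \<bar>\<Sum>j\<in>?S. D j\<bar>" by linarith
  also have "\<dots> \<le> (24 * \<delta> + 2 * \<delta> * E) + 3 * (24 * \<delta> + 2 * \<delta> * E)"
  proof (rule add_mono)
    \<comment> \<open>With \<open>j = 0\<close> and \<open>b = 0\<close> the distance is 0, so the
      general bound applies to the single intervals.\<close>
    show D0: "\<bar>D 0\<bar> \<le> 24 * \<delta> + 2 * \<delta> * E" using D[of 0 0] Q \<delta> by simp
    have "\<bar>\<Sum>j\<in>?S. D j\<bar> \<le> (\<Sum>j\<in>?S. 24 * \<delta> + 2 * \<delta> * E)"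
      using D by (intro order_trans[OF sum_abs] sum_mono) auto
    also have "\<dots> = real (card ?S) * (24 * \<delta> + 2 * \<delta> * E)" by simp
    also have "\<dots> \<le> 3 * (24 * \<delta> + 2 * \<delta> * E)"
      using card_close_differences D0 by (intro mult_right_mono) auto
    finally show "\<bar>\<Sum>j\<in>?S. D j\<bar> \<le> 3 * (24 * \<delta> + 2 * \<delta> * E)" .
  qed
  also have "\<dots> = 96 * \<delta> + 8 * \<delta> * E" by simp
  finally show ?thesis unfolding full .
qed

end

end

section \<open>Asymptotic independence\<close>

lemma dvd_mod_add_iff:
  fixes p :: "'a::euclidean_semiring_cancel"
  assumes "p dvd L"
  shows "p dvd m mod L + j \<longleftrightarrow> p dvd m + j"
proof -
  have "m + j = L * (m div L) + m mod L + j" by (simp only: mult_div_mod_eq)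
  also have "\<dots> = (m mod L + j) + L * (m div L)" by (simp only: ac_simps)
  finally have "m + j = (m mod L + j) + L * (m div L)" .
  then show ?thesis using dvd_add_left_iff[OF dvd_mult2[OF assms], of "m mod L + j" "m div L"] by (simp only:)
qed

lemma coprime_on_periodic:
  assumes "\<And>p. p \<in> S \<Longrightarrow> p dvd L"
  shows "coprime_on S (m + j) (a + b) \<longleftrightarrow> coprime_on S (m mod L + j) (a mod int L + b)"
proof -
  have "p dvd m mod L + j \<longleftrightarrow> p dvd m + j" "int p dvd a mod int L + b \<longleftrightarrow> int p dvd a + b"
    if "p \<in> S" for p
    by (intro dvd_mod_add_iff, use assms[OF that] in simp)+
  then show ?thesis unfolding coprime_on_def by blast
qed

text \<open>The pair condition is periodic modulo the product of \<open>S\<close>. The density of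
  pairs need not be computed: both windows have the same density factor \<open>?d g\<close>, which
  cancels. The constant is uniform in \<open>Q\<close>, \<open>j\<close> and
  \<open>b\<close>.\<close>

lemma coprime_on_pair_count:
  fixes \<alpha> u v \<epsilon> :: real
  assumes \<alpha>: "0 < \<alpha>" "\<alpha> < 1" "\<alpha> \<notin> \<rat>" and S: "finite S" "0 \<notin> S"
    and uv: "0 \<le> u" "u \<le> v" "v \<le> 1" and "0 < \<epsilon>"
  shows "\<exists>C\<ge>0. \<forall>Q j b. \<bar>pair_count \<alpha> Q (coprime_on S) j b u v
    - (v - u) * pair_count \<alpha> Q (coprime_on S) j b 0 1\<bar> \<le> \<epsilon> * real Q + C"
proof -
  define L where "L = \<Prod>S"
  have L: "0 < L" unfolding L_def using S by (auto intro!: prod_pos gr0I)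
  have dvd: "p dvd L" if "p \<in> S" for p unfolding L_def using S that by (auto intro: dvd_prodI)
  have e: "0 < \<epsilon> / 2" using assms by simp
  let ?c = "\<lambda>g N u v. real (card {m \<in> {1..<N}. g m \<lfloor>real m * \<alpha>\<rfloor> \<and> frac (real m * \<alpha>) \<in> {u<..<v}})"
  let ?d = "\<lambda>g. real (card {(r, s) \<in> {..<L} \<times> {0..<int L}. g r s}) / (real L)\<^sup>2"
  from card_periodic[OF \<alpha> uv e L] obtain C where C: "0 \<le> C"
    and bd: "\<forall>N g. (\<forall>m a. g m a \<longleftrightarrow> g (m mod L) (a mod int L)) \<longrightarrow>
      \<bar>?c g N u v - ?d g * (v - u) * real N\<bar> \<le> \<epsilon> / 2 * real N + C" by blast
  from card_periodic[OF \<alpha> order_refl zero_le_one order_refl e L] obtain C' where C': "0 \<le> C'"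
    and bd': "\<forall>N g. (\<forall>m a. g m a \<longleftrightarrow> g (m mod L) (a mod int L)) \<longrightarrow>
      \<bar>?c g N 0 1 - ?d g * (1 - 0) * real N\<bar> \<le> \<epsilon> / 2 * real N + C'" by blast
  show ?thesis
  proof (intro exI[of _ "C + C'"] conjI allI)
    show "0 \<le> C + C'" using C C' by simp
    fix Q j b
    define g where "g m a \<longleftrightarrow> coprime_on S m a \<and> coprime_on S (m + j) (a + b)" for m a
    have g: "\<forall>m a. g m a \<longleftrightarrow> g (m mod L) (a mod int L)"
    proof (intro allI)
      fix m a
      have "coprime_on S m a \<longleftrightarrow> coprime_on S (m mod L) (a mod int L)"
        using coprime_on_periodic[OF dvd, of S m 0 a 0] by simp
      moreover have "coprime_on S (m + j) (a + b) \<longleftrightarrow> coprime_on S (m mod L + j) (a mod int L + b)"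
        by (rule coprime_on_periodic[OF dvd])
      ultimately show "g m a \<longleftrightarrow> g (m mod L) (a mod int L)" unfolding g_def by blast
    qed
    let ?N = "Q - j"
    have pc: "pair_count \<alpha> Q (coprime_on S) j b u v = ?c g ?N u v" for u v
      unfolding pair_count_def g_def ..
    have 1: "\<bar>?c g ?N u v - ?d g * (v - u) * real ?N\<bar> \<le> \<epsilon> / 2 * real ?N + C"
      using bd g by blast
    have "\<bar>?c g ?N 0 1 - ?d g * (1 - 0) * real ?N\<bar> \<le> \<epsilon> / 2 * real ?N + C'"
      using bd' g by blast
    then have "\<bar>(v - u) * (?c g ?N 0 1 - ?d g * (1 - 0) * real ?N)\<bar> \<le> 1 * (\<epsilon> / 2 * real ?N + C')"
      unfolding abs_mult using uv by (intro mult_mono) auto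
    then have 2: "\<bar>(v - u) * ?c g ?N 0 1 - ?d g * (v - u) * real ?N\<bar> \<le> \<epsilon> / 2 * real ?N + C'"
      by (simp add: algebra_simps)
    have 3: "\<epsilon> / 2 * real ?N \<le> \<epsilon> / 2 * real Q" using e by (intro mult_left_mono) auto
    have tri: "\<bar>x - z\<bar> \<le> h + C \<Longrightarrow> \<bar>y - z\<bar> \<le> h + C' \<Longrightarrow> h \<le> \<epsilon> / 2 * r \<Longrightarrow> \<bar>x - y\<bar> \<le> \<epsilon> * r + (C + C')"
      for x y z h r by linarith
    show "\<bar>pair_count \<alpha> Q (coprime_on S) j b u v - (v - u) * pair_count \<alpha> Q (coprime_on S) j b 0 1\<bar>
      \<le> \<epsilon> * real Q + (C + C')"
      unfolding pc by (rule tri[OF 1 2 3])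
  qed
qed

lemma coprime_on_nbhds_equidistributed:
  fixes \<alpha> \<tau> u v :: real and Q :: "nat \<Rightarrow> nat"
  assumes \<alpha>: "0 < \<alpha>" "\<alpha> < 1" "\<alpha> \<notin> \<rat>" and \<tau>: "0 < \<tau>" "\<tau> < 1 / 3" and S: "finite S" "0 \<notin> S"
    and uv: "0 \<le> u" "u \<le> v" "v \<le> 1"
    and sep: "\<And>k j b. 0 < j \<Longrightarrow> j < Q k \<Longrightarrow> 1 / (2 * real (Q k)) < \<bar>real j * \<alpha> - of_int b\<bar>"
    and Q: "\<And>k. 0 < Q k" "filterlim Q at_top sequentially"
  defines "V \<equiv> \<lambda>k. \<Union>m\<in>marked \<alpha> (Q k) (coprime_on S). orbit_nbhd \<alpha> (\<tau> / real (Q k)) m"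
  shows "(\<lambda>k. measure lebesgue (V k \<inter> {u<..<v}) - (v - u) * measure lebesgue (V k)) \<longlonglongrightarrow> 0"
proof (rule LIMSEQ_I)
  fix \<epsilon> :: real assume \<epsilon>: "0 < \<epsilon>"
  \<comment> \<open>In the discrepancy bound, \<open>8 * \<delta>\<close> times
    \<open>\<epsilon> / 16 * Q\<close> becomes \<open>\<tau> * \<epsilon> / 2\<close>.\<close>
  have "0 < \<epsilon> / 16" using \<epsilon> by simp
  from coprime_on_pair_count[OF \<alpha> S uv this] obtain C where C: "0 \<le> C"
    and pc: "\<And>Q j b. \<bar>pair_count \<alpha> Q (coprime_on S) j b u v
      - (v - u) * pair_count \<alpha> Q (coprime_on S) j b 0 1\<bar> \<le> \<epsilon> / 16 * real Q + C" by blast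
  have bound: "\<bar>measure lebesgue (V k \<inter> {u<..<v}) - (v - u) * measure lebesgue (V k)\<bar>
    \<le> \<epsilon> / 2 + (96 + 8 * C) / real (Q k)" for k
  proof -
    let ?\<delta> = "\<tau> / real (Q k)"
    have d: "0 < ?\<delta>" "3 * ?\<delta> * real (Q k) < 1" using Q(1)[of k] \<tau> by auto
    have "\<bar>measure lebesgue (V k \<inter> {u<..<v}) - (v - u) * measure lebesgue (V k)\<bar>
      \<le> 96 * ?\<delta> + 8 * ?\<delta> * (\<epsilon> / 16 * real (Q k) + C)"
      unfolding V_def using marked_nbhds_discrepancy[OF sep d Q(1) pc uv] .
    also have "\<dots> = \<tau> * (\<epsilon> / 2 + (96 + 8 * C) / real (Q k))"
      using Q(1)[of k] by (simp add: field_simps)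
    also have "\<dots> \<le> 1 * (\<epsilon> / 2 + (96 + 8 * C) / real (Q k))"
      using \<tau> \<epsilon> C by (intro mult_right_mono) auto
    finally show ?thesis by simp
  qed
  have "(\<lambda>k. (96 + 8 * C) / real (Q k)) \<longlonglongrightarrow> 0"
    by (intro tendsto_divide_0[OF tendsto_const] filterlim_at_top_imp_at_infinity
      filterlim_compose[OF filterlim_real_sequentially Q(2)])
  then have "\<forall>\<^sub>F k in sequentially. (96 + 8 * C) / real (Q k) < \<epsilon> / 2"
    using \<epsilon> by (intro order_tendstoD) auto
  then obtain k0 where k0: "\<And>k. k0 \<le> k \<Longrightarrow> (96 + 8 * C) / real (Q k) < \<epsilon> / 2"
    unfolding eventually_sequentially by blast
  show "\<exists>no. \<forall>k\<ge>no. norm (measure lebesgue (V k \<inter> {u<..<v}) - (v - u) * measure lebesgue (V k) - 0) < \<epsilon>"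
  proof (intro exI[of _ k0] allI impI)
    fix k assume "k0 \<le> k"
    from k0[OF this] show "norm (measure lebesgue (V k \<inter> {u<..<v}) - (v - u) * measure lebesgue (V k) - 0) < \<epsilon>"
      using bound[of k] unfolding real_norm_def diff_0_right by linarith
  qed
qed

section \<open>Transfer to the coprime indices and to finite unions of intervals\<close>

lemma measure_UN_diff_le:
  fixes B :: "nat \<Rightarrow> real set"
  assumes "finite M" "J \<subseteq> M" "\<And>m. B m \<in> lmeasurable" "\<And>m. measure lebesgue (B m) \<le> w" "A \<in> lmeasurable"
  shows "0 \<le> measure lebesgue ((\<Union>m\<in>M. B m) \<inter> A) - measure lebesgue ((\<Union>m\<in>J. B m) \<inter> A)"
    and "measure lebesgue ((\<Union>m\<in>M. B m) \<inter> A) - measure lebesgue ((\<Union>m\<in>J. B m) \<inter> A) \<le> w * real (card M - card J)"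
proof -
  have fin: "finite J" "finite (M - J)" using assms finite_subset by auto
  have ms: "(\<Union>m\<in>I. B m) \<inter> A \<in> lmeasurable" "(\<Union>m\<in>I. B m) \<in> lmeasurable" if "finite I" for I
    using that assms by (auto intro!: fmeasurable.Int fmeasurable.finite_UN)
  show "0 \<le> measure lebesgue ((\<Union>m\<in>M. B m) \<inter> A) - measure lebesgue ((\<Union>m\<in>J. B m) \<inter> A)"
    using measure_mono_fmeasurable[OF _ _ ms(1)[OF assms(1)], of "(\<Union>m\<in>J. B m) \<inter> A"] ms(1)[OF fin(1)] assms(2)
    by (force dest: fmeasurableD)
  have "measure lebesgue ((\<Union>m\<in>M. B m) \<inter> A) \<le> measure lebesgue (((\<Union>m\<in>J. B m) \<inter> A) \<union> (\<Union>m\<in>M - J. B m))"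
    using ms fin assms(1) by (intro measure_mono_fmeasurable fmeasurable.Un fmeasurableD) auto
  also have "\<dots> \<le> measure lebesgue ((\<Union>m\<in>J. B m) \<inter> A) + measure lebesgue (\<Union>m\<in>M - J. B m)"
    using ms fin by (intro measure_Un_le fmeasurableD) auto
  also have "measure lebesgue (\<Union>m\<in>M - J. B m) \<le> (\<Sum>m\<in>M - J. measure lebesgue (B m))"
    using fin assms(3) by (intro measure_UNION_le fmeasurableD) auto
  also have "\<dots> \<le> (\<Sum>m\<in>M - J. w)" by (intro sum_mono assms(4))
  also have "\<dots> = w * real (card M - card J)"
    using card_Diff_subset[OF fin(1) assms(2)] by simp
  finally show "measure lebesgue ((\<Union>m\<in>M. B m) \<inter> A) - measure lebesgue ((\<Union>m\<in>J. B m) \<inter> A) \<le> w * real (card M - card J)"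
    by simp
qed

text \<open>The discrepancy is additive under inclusion-exclusion, which handles overlapping
  intervals. Intersecting the first intervals with the new one gives a family over the same
  \<open>F\<close>, so the induction hypothesis applies to it with other endpoints.\<close>

lemma equidistributed_finite_union:
  fixes V :: "nat \<Rightarrow> real set" and u v :: "nat \<Rightarrow> real"
  assumes V: "\<And>k. V k \<in> lmeasurable"
    and int: "\<And>u v. 0 \<le> u \<Longrightarrow> u \<le> v \<Longrightarrow> v \<le> 1 \<Longrightarrow>
      (\<lambda>k. measure lebesgue (V k \<inter> {u<..<v}) - (v - u) * measure lebesgue (V k)) \<longlonglongrightarrow> 0"
    and "finite F" "\<And>i. i \<in> F \<Longrightarrow> 0 \<le> u i" "\<And>i. i \<in> F \<Longrightarrow> v i \<le> 1"
  defines "A \<equiv> \<Union>i\<in>F. {u i<..<v i}"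
  shows "(\<lambda>k. measure lebesgue (A \<inter> V k) - measure lebesgue A * measure lebesgue (V k)) \<longlonglongrightarrow> 0"
  using assms(3-5) unfolding A_def
proof (induction F arbitrary: u v rule: finite_induct)
  case (insert s F)
  define D where "D A k = measure lebesgue (A \<inter> V k) - measure lebesgue A * measure lebesgue (V k)" for A k
  let ?A = "\<Union>i\<in>F. {u i<..<v i}" and ?B = "{u s<..<v s}"
  \<comment> \<open>Disjoint intervals give endpoints in the wrong order and hence an empty
    interval; no order of \<open>u i\<close> and \<open>v i\<close> is assumed.\<close>
  let ?AB = "\<Union>i\<in>F. {max (u i) (u s)<..<min (v i) (v s)}"
  have "D ?A \<longlonglongrightarrow> 0"
    unfolding D_def using insert.prems by (intro insert.IH) auto
  moreover have "D ?AB \<longlonglongrightarrow> 0"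
    unfolding D_def using insert.prems by (intro insert.IH) (auto simp: le_max_iff_disj min_le_iff_disj)
  moreover have "D ?B \<longlonglongrightarrow> 0"
  proof (cases "u s \<le> v s")
    case True
    then have "measure lebesgue ?B = v s - u s" by simp
    then have "D ?B = (\<lambda>k. measure lebesgue (V k \<inter> ?B) - (v s - u s) * measure lebesgue (V k))"
      unfolding D_def by (simp only: Int_commute)
    then show ?thesis using int[of "u s" "v s"] insert.prems True by simp
  next
    case False
    then have "?B = {}" by simp
    then show ?thesis unfolding D_def by simp
  qed
  ultimately have "(\<lambda>k. D ?A k + D ?B k - D ?AB k) \<longlonglongrightarrow> 0 + 0 - 0"
    by (intro tendsto_add tendsto_diff)
  moreover have "D (\<Union>i\<in>insert s F. {u i<..<v i}) k = D ?A k + D ?B k - D ?AB k" for k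
  proof -
    have AB: "?AB = ?A \<inter> ?B" by auto
    have A: "?A \<in> lmeasurable" using insert.hyps by (intro fmeasurable.finite_UN) auto
    have B: "?B \<in> lmeasurable" by simp
    have "(\<Union>i\<in>insert s F. {u i<..<v i}) = ?A \<union> ?B" by auto
    moreover have "(?A \<union> ?B) \<inter> V k = (?A \<inter> V k) \<union> (?B \<inter> V k)" "(?A \<inter> V k) \<inter> (?B \<inter> V k) = (?A \<inter> ?B) \<inter> V k"
      by blast+
    ultimately show ?thesis
      unfolding D_def AB using measure_Un3[OF A B] measure_Un3[OF fmeasurable.Int[OF A V] fmeasurable.Int[OF B V]]
      by (simp only:) (simp only: algebra_simps)
  qed
  ultimately show ?case unfolding D_def by simp
qed simp

theorem theorem3p4:
  fixes \<alpha> \<tau> :: real and n :: "nat \<Rightarrow> nat" and l\<^sub>1 :: nat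
  assumes "0 < \<alpha>" and "\<alpha> < 1" and "\<alpha> \<notin> \<rat>"
    and "0 < \<tau>" and "\<tau> < 1 / 3"
    and "strict_mono n" and "\<And>k. 0 < n k"
    and "\<And>I :: real set. is_interval I \<Longrightarrow> I \<subseteq> {0..<1} \<Longrightarrow>
      (\<lambda>k. real (card {m \<in> J_set \<alpha> (n k). frac (real m * \<alpha>) \<in> I})
            - \<kappa> * measure lebesgue I * real (cf_denom \<alpha> (n k + 1)))
      \<in> o(\<lambda>k. real (cf_denom \<alpha> (n k + 1)))"
  shows "(\<lambda>l\<^sub>2. measure lebesgue (I_set \<alpha> \<tau> (n l\<^sub>1) \<inter> I_set \<alpha> \<tau> (n l\<^sub>2))
            - measure lebesgue (I_set \<alpha> \<tau> (n l\<^sub>1)) * measure lebesgue (I_set \<alpha> \<tau> (n l\<^sub>2)))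
         \<in> o(\<lambda>l\<^sub>2. 1)"
proof -
  note \<alpha> = assms(1-3)
  define Q where "Q k = cf_denom \<alpha> (n k + 1)" for k
  have sep: "1 / (2 * real (Q k)) < \<bar>real j * \<alpha> - of_int b\<bar>" if "0 < j" "j < Q k" for k j b
    using cf_denom_separation[OF \<alpha>, of j "n k" b] that unfolding Q_def by simp
  have Qk: "k < Q k" for k
    using cf_denom_ge[OF \<alpha>, of "n k"] seq_suble[OF assms(6), of k] unfolding Q_def by simp
  then have Q: "0 < Q k" for k using gr_zeroI by (metis not_less_zero)
  have Qlim: "filterlim Q at_top sequentially"
    using Qk by (intro filterlim_at_top_mono[OF filterlim_ident] always_eventually) (simp add: less_imp_le)
  define \<delta> where "\<delta> k = \<tau> / real (Q k)" for k
  have \<delta>: "0 < \<delta> k" "3 * \<delta> k * real (Q k) < 1" for k using Q[of k] assms(4,5) by (auto simp: \<delta>_def)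
  have J: "J_set \<alpha> (n k) = {m \<in> {1..<Q k}. gcd \<lfloor>real m * \<alpha>\<rfloor> (int m) = 1}" for k
    unfolding J_set_def Q_def using Q[of k] by (auto simp: Q_def)
  have I: "I_set \<alpha> \<tau> (n k) = (\<Union>m\<in>J_set \<alpha> (n k). orbit_nbhd \<alpha> (\<delta> k) m)" for k
    unfolding I_set_def \<delta>_def Q_def ..
  have Jlim: "(\<lambda>k. real (card (J_set \<alpha> (n k))) / real (Q k)) \<longlonglongrightarrow> \<kappa>"
  proof -
    have "{m \<in> J_set \<alpha> (n k). frac (real m * \<alpha>) \<in> {0..<1}} = J_set \<alpha> (n k)" for k
      using frac_lt_1 by auto
    then have "(\<lambda>k. real (card (J_set \<alpha> (n k))) - \<kappa> * real (Q k)) \<in> o(\<lambda>k. real (Q k))"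
      using assms(8)[of "{0..<1}"] unfolding Q_def by (simp add: is_interval_co)
    then have "(\<lambda>k. (real (card (J_set \<alpha> (n k))) - \<kappa> * real (Q k)) / real (Q k)) \<longlonglongrightarrow> 0"
      by (rule smalloD_tendsto)
    then have "(\<lambda>k. (real (card (J_set \<alpha> (n k))) - \<kappa> * real (Q k)) / real (Q k) + \<kappa>) \<longlonglongrightarrow> 0 + \<kappa>"
      by (intro tendsto_add tendsto_const)
    moreover have "(real (card (J_set \<alpha> (n k))) - \<kappa> * real (Q k)) / real (Q k) + \<kappa> = real (card (J_set \<alpha> (n k))) / real (Q k)" for k
      using Q[of k] by (simp add: field_simps)
    ultimately show ?thesis by simp
  qed
  have int: "(\<lambda>k. measure lebesgue (I_set \<alpha> \<tau> (n k) \<inter> {u<..<v}) - (v - u) * measure lebesgue (I_set \<alpha> \<tau> (n k))) \<longlonglongrightarrow> 0"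
    if uv: "0 \<le> u" "u \<le> v" "v \<le> 1" for u v
  proof (rule LIMSEQ_I)
    fix \<epsilon> :: real assume \<epsilon>: "0 < \<epsilon>"
    \<comment> \<open>An upper bound is enough, as the sieved set contains \<open>J_set\<close>. The
      excess density below \<open>\<epsilon> / 8\<close> becomes a measure below
      \<open>\<epsilon> / 4\<close>, because \<open>2 * \<tau>\<close> is at most 2.\<close>
    have "\<forall>\<^sub>F P in sequentially. (\<Prod>p\<in>{p. prime p \<and> p \<le> P}. 1 - 1 / real p ^ 2) < \<kappa> + \<epsilon> / 8"
      using prod_primes_tendsto_kappa by (rule order_tendstoD) (use \<epsilon> in simp)
    then obtain P where P: "(\<Prod>p\<in>{p. prime p \<and> p \<le> P}. 1 - 1 / real p ^ 2) < \<kappa> + \<epsilon> / 8"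
      unfolding eventually_sequentially by blast
    define S where "S = {p::nat. prime p \<and> p \<le> P}"
    have S: "finite S" "0 \<notin> S" "\<And>p. p \<in> S \<Longrightarrow> prime p" unfolding S_def by auto
    define M where "M k = marked \<alpha> (Q k) (coprime_on S)" for k
    define V where "V k = (\<Union>m\<in>M k. orbit_nbhd \<alpha> (\<delta> k) m)" for k
    have M: "M k = {m \<in> {1..<Q k}. coprime_on S m \<lfloor>real m * \<alpha>\<rfloor>}" for k
      unfolding M_def marked_def ..
    have finM: "finite (M k)" for k unfolding M by simp
    have JM: "J_set \<alpha> (n k) \<subseteq> M k" for k
    proof
      fix m assume m: "m \<in> J_set \<alpha> (n k)"
      have "\<not> (p dvd m \<and> int p dvd \<lfloor>real m * \<alpha>\<rfloor>)" if "p \<in> S" for p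
      proof
        assume "p dvd m \<and> int p dvd \<lfloor>real m * \<alpha>\<rfloor>"
        then have "int p dvd gcd \<lfloor>real m * \<alpha>\<rfloor> (int m)" by (intro gcd_greatest) auto
        moreover have "gcd \<lfloor>real m * \<alpha>\<rfloor> (int m) = 1" using m unfolding J by blast
        ultimately have "int p dvd 1" by (simp only:)
        then show False using S(3)[OF that] by (simp add: prime_nat_iff)
      qed
      then show "m \<in> M k" using m unfolding M J coprime_on_def by simp
    qed
    have "(\<lambda>k. real (card (M k)) / real (Q k)) \<longlonglongrightarrow> (\<Prod>p\<in>S. 1 - 1 / real p ^ 2)"
      using filterlim_compose[OF coprime_on_density[OF \<alpha> S(1,3), of 1] Qlim] unfolding M by simp
    then have "(\<lambda>k. real (card (M k)) / real (Q k) - real (card (J_set \<alpha> (n k))) / real (Q k))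
      \<longlonglongrightarrow> (\<Prod>p\<in>S. 1 - 1 / real p ^ 2) - \<kappa>" by (intro tendsto_diff Jlim)
    then have ev1: "\<forall>\<^sub>F k in sequentially. real (card (M k)) / real (Q k) - real (card (J_set \<alpha> (n k))) / real (Q k) < \<epsilon> / 8"
      by (rule order_tendstoD) (use P in \<open>simp add: S_def\<close>)
    have "(\<lambda>k. measure lebesgue (V k \<inter> {u<..<v}) - (v - u) * measure lebesgue (V k)) \<longlonglongrightarrow> 0"
      unfolding V_def M_def \<delta>_def
      by (rule coprime_on_nbhds_equidistributed[OF \<alpha> assms(4,5) S(1,2) uv sep Q Qlim])
    from order_tendstoD(2)[OF tendsto_rabs_zero[OF this] half_gt_zero[OF \<epsilon>]]
    have ev2: "\<forall>\<^sub>F k in sequentially. \<bar>measure lebesgue (V k \<inter> {u<..<v}) - (v - u) * measure lebesgue (V k)\<bar> < \<epsilon> / 2" .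
    have "\<forall>\<^sub>F k in sequentially. norm (measure lebesgue (I_set \<alpha> \<tau> (n k) \<inter> {u<..<v})
        - (v - u) * measure lebesgue (I_set \<alpha> \<tau> (n k)) - 0) < \<epsilon>"
      using ev1 ev2
    proof eventually_elim
      case (elim k)
      let ?w = "2 * \<delta> k * real (card (M k) - card (J_set \<alpha> (n k)))"
      have w: "?w < \<epsilon> / 4"
      proof -
        have c: "card (J_set \<alpha> (n k)) \<le> card (M k)" by (rule card_mono[OF finM JM])
        have "?w = 2 * \<tau> * (real (card (M k)) / real (Q k) - real (card (J_set \<alpha> (n k))) / real (Q k))"
          unfolding \<delta>_def by (simp add: of_nat_diff[OF c] diff_divide_distrib[symmetric])
        also have "\<dots> \<le> 2 * 1 * (real (card (M k)) / real (Q k) - real (card (J_set \<alpha> (n k))) / real (Q k))"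
          using assms(4,5) c by (intro mult_right_mono) (auto simp: divide_right_mono)
        also have "\<dots> < 2 * 1 * (\<epsilon> / 8)" by (intro mult_strict_left_mono elim(1)) simp
        also have "\<dots> = \<epsilon> / 4" by simp
        finally show ?thesis .
      qed
      have nb: "orbit_nbhd \<alpha> (\<delta> k) m \<in> lmeasurable" "measure lebesgue (orbit_nbhd \<alpha> (\<delta> k) m) \<le> 2 * \<delta> k" for m
        using \<delta>(1)[of k] by auto
      note diff = measure_UN_diff_le[where B = "\<lambda>m. orbit_nbhd \<alpha> (\<delta> k) m", OF finM[of k] JM[of k] nb, folded I[of k] V_def[of k]]
      have a: "0 \<le> measure lebesgue (V k \<inter> {u<..<v}) - measure lebesgue (I_set \<alpha> \<tau> (n k) \<inter> {u<..<v})"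
        "measure lebesgue (V k \<inter> {u<..<v}) - measure lebesgue (I_set \<alpha> \<tau> (n k) \<inter> {u<..<v}) \<le> ?w"
        using diff[where A = "{u<..<v}", OF lmeasurable_interval(2)] .
      \<comment> \<open>Intersecting with the open unit interval changes nothing, so the comparison
        of measures inside a window also covers the full measures.\<close>
      have full: "V k \<inter> {0<..<1} = V k" "I_set \<alpha> \<tau> (n k) \<inter> {0<..<1} = I_set \<alpha> \<tau> (n k)"
      proof -
        have "orbit_nbhd \<alpha> (\<delta> k) m \<subseteq> {0<..<1}" if "m \<in> M k" for m
          using orbit_nbhd_subset[OF sep \<delta> Q, of k m] that unfolding M by simp
        then show "V k \<inter> {0<..<1} = V k" "I_set \<alpha> \<tau> (n k) \<inter> {0<..<1} = I_set \<alpha> \<tau> (n k)"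
          unfolding V_def I using JM[of k] by blast+
      qed
      have b: "0 \<le> measure lebesgue (V k) - measure lebesgue (I_set \<alpha> \<tau> (n k))"
        "measure lebesgue (V k) - measure lebesgue (I_set \<alpha> \<tau> (n k)) \<le> ?w"
        using diff[where A = "{0<..<1}", OF lmeasurable_interval(2), unfolded full] .
      have b': "0 \<le> (v - u) * (measure lebesgue (V k) - measure lebesgue (I_set \<alpha> \<tau> (n k)))"
        "(v - u) * (measure lebesgue (V k) - measure lebesgue (I_set \<alpha> \<tau> (n k))) \<le> 1 * ?w"
        using b uv by (intro mult_nonneg_nonneg mult_mono; linarith)+
      have tri: "\<bar>x' - z'\<bar> < \<epsilon> / 2 \<Longrightarrow> 0 \<le> x' - x \<Longrightarrow> x' - x \<le> r \<Longrightarrow> 0 \<le> z' - z \<Longrightarrow> z' - z \<le> 1 * r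
        \<Longrightarrow> r < \<epsilon> / 4 \<Longrightarrow> \<bar>x - z\<bar> < \<epsilon>" for x x' z z' r by linarith
      show ?case unfolding real_norm_def diff_0_right
        by (rule tri[OF elim(2) a b'[unfolded right_diff_distrib] w])
    qed
    then show "\<exists>no. \<forall>k\<ge>no. norm (measure lebesgue (I_set \<alpha> \<tau> (n k) \<inter> {u<..<v})
        - (v - u) * measure lebesgue (I_set \<alpha> \<tau> (n k)) - 0) < \<epsilon>"
      unfolding eventually_sequentially .
  qed
  have finJ: "finite (J_set \<alpha> (n k))" for k unfolding J by simp
  have meas: "I_set \<alpha> \<tau> (n k) \<in> lmeasurable" for k
    unfolding I using finJ by (intro fmeasurable.finite_UN) auto
  have nb01: "orbit_nbhd \<alpha> (\<delta> l\<^sub>1) m \<subseteq> {0<..<1}" if "m \<in> J_set \<alpha> (n l\<^sub>1)" for m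
    using orbit_nbhd_subset[OF sep \<delta> Q, of l\<^sub>1 m] that unfolding J by simp
  have "(\<lambda>l\<^sub>2. measure lebesgue ((\<Union>m\<in>J_set \<alpha> (n l\<^sub>1). orbit_nbhd \<alpha> (\<delta> l\<^sub>1) m) \<inter> I_set \<alpha> \<tau> (n l\<^sub>2))
    - measure lebesgue (\<Union>m\<in>J_set \<alpha> (n l\<^sub>1). orbit_nbhd \<alpha> (\<delta> l\<^sub>1) m) * measure lebesgue (I_set \<alpha> \<tau> (n l\<^sub>2))) \<longlonglongrightarrow> 0"
  proof (rule equidistributed_finite_union[OF meas int finJ])
    fix m assume m: "m \<in> J_set \<alpha> (n l\<^sub>1)"
    \<comment> \<open>Only for a nonempty open interval does inclusion in the unit interval give
      inequalities between endpoints.\<close>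
    have "frac (real m * \<alpha>) - \<delta> l\<^sub>1 < frac (real m * \<alpha>) + \<delta> l\<^sub>1" using \<delta>(1)[of l\<^sub>1] by simp
    with nb01[OF m] show "0 \<le> frac (real m * \<alpha>) - \<delta> l\<^sub>1" "frac (real m * \<alpha>) + \<delta> l\<^sub>1 \<le> 1"
      by (simp_all add: greaterThanLessThan_subseteq_greaterThanLessThan)
  qed
  then show ?thesis unfolding I[of l\<^sub>1, symmetric] by (intro smalloI_tendsto) auto
qed

end
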